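(* Let $\mathbb{D}$ be a dessin with one vertex, let $m=e(\mathbb{D})$ be its number of edges (chords), and let $\mathrm{IM}(\mathbb{D})$ be its intersection matrix. Then the characteristic polynomial of $\mathrm{IM}(\mathbb{D})$ satisfies $$\det(\mathrm{IM}(\mathbb{D})-xI)=(-1)^m\sum_{j=0}^{\lfloor m/2\rfloor}s(j,\mathbb{D})\,x^{m-2j}.$$ In particular, if $\mathbb{D}=\mathbb{D}(A)$ is the all-$A$ dessin of a connected projection of a link $K$, then $$\det(K)=\bigl|\det\bigl(\mathrm{IM}(\mathbb{D})-\sqrt{-1}\,I\bigr)\bigr|.$$
   Context: A dessin (d'enfant; combinatorial map, oriented ribbon graph) is a finite multigraph (loops and multiple edges allowed) with a cyclic order on the edge-ends at each vertex; equivalently a graph embedded in an orientable surface so that all complementary regions (faces) are disks. For a dessin $\mathbb{D}$, let $v,e,f,k$ denote the numbers of vertices, edges, faces and connected components; faces are counted as boundary components of the associated ribbon surface (an isolated vertex has one face). The genus is $g(\mathbb{D})=\frac{2k(\mathbb{D})-v(\mathbb{D})+e(\mathbb{D})-f(\mathbb{D})}{2}$. A spanning sub-dessin $\mathbb{H}\subset\mathbb{D}$ is obtained by deleting edges (keeping all vertices), with induced cyclic orders; $f(\mathbb{H}),k(\mathbb{H}),g(\mathbb{H})$ are computed for $\mathbb{H}$ as a dessin in its own right. A spanning quasi-tree of genus $j$ (spanning $j$-quasi-tree) of a connected dessin $\mathbb{D}$ is a connected spanning sub-dessin $\mathbb{H}$ with $g(\mathbb{H})=j$, $f(\mathbb{H})=1$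 and $e(\mathbb{H})=v(\mathbb{H})-1+2j$ (any two of these three conditions imply the third). $s(j,\mathbb{D})$ denotes the number of spanning $j$-quasi-trees of $\mathbb{D}$. Chord diagram and intersection matrix: a dessin with one vertex is the same as a chord diagram: the circle corresponds to the vertex, the chords to the edges, and the cyclic order at the vertex gives the cyclic order of chord endpoints on the circle. Fix a base point on the circle disjoint from the chords and number the chords consecutively in the order in which they are first met travelling along the circle from the base point. The intersection matrix $\mathrm{IM}(\mathbb{D})$ is the $m\times m$ matrix with $\mathrm{IM}(\mathbb{D})_{ij}=\mathrm{sign}(i-j)$ if the $i$-th and $j$-th chords intersect (their endpoints interleave on the circle), and $0$ otherwise (in particular the diagonal is zero). All-$A$ dessin $\mathbb{D}(A)$ of a link diagram $P$: at each crossing the $A$-splicing is the smoothing that joins the two regions swept out when the over-strand is rotated counterclockwise onto the under-strand (the $B$-splicing is the other smoothing). Splice every crossing by its $A$-splicing to get disjoint circles in the plane, together with one arc per crossing recording the splice. Vertices of $\mathbb{D}(A)$ are the circles, edges are the crossings (arcs). Orient each circle clockwise or anti-clockwise according to whether it lies inside an odd or even number of the circles; the cyclic order at a vertex is the order in which arc-ends are met along the oriented circle. The determinant $\det(K)$ of a link $K$ is the absolute value of its Jones polynomial (equivalently, of its Alexander polynomial) at $-1$. *)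

theory Defs
  imports
    Complex_Main
    "HOL-Combinatorics.Orbits"
    "HOL-Computational_Algebra.Polynomial"
    "Jordan_Normal_Form.Determinant"
begin

section \<open>Dessins\<close>

text \<open>
  A dart is an edge-end. \<open>vtx d\<close> is the vertex at which the dart \<open>d\<close> sits, \<open>nxt d\<close> is its
  counterclockwise successor at that vertex, and \<open>opp d\<close> is the other end of the same edge.
  Vertices are recorded separately from darts because isolated vertices are allowed.
\<close>

record ('v, 'd) dessin =
  verts :: "'v set"
  darts :: "'d set"
  vtx :: "'d \<Rightarrow> 'v"
  nxt :: "'d \<Rightarrow> 'd"
  opp :: "'d \<Rightarrow> 'd"

definition dessin :: "('v, 'd) dessin \<Rightarrow> bool" where
  "dessin D \<longleftrightarrow>
     finite (verts D) \<and> finite (darts D) \<and> vtx D ` darts D \<subseteq> verts D \<and>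
     nxt D permutes darts D \<and>
     (\<forall>d\<in>darts D. \<forall>d'\<in>darts D. vtx D d = vtx D d' \<longleftrightarrow> d' \<in> orbit (nxt D) d) \<and>
     opp D permutes darts D \<and>
     (\<forall>d\<in>darts D. opp D d \<noteq> d \<and> opp D (opp D d) = d)"

definition edge :: "('v, 'd) dessin \<Rightarrow> 'd \<Rightarrow> 'd set" where
  "edge D d = {d, opp D d}"

definition edges :: "('v, 'd) dessin \<Rightarrow> 'd set set" where
  "edges D = edge D ` darts D"

text \<open>
  \<open>face D d\<close> is the boundary component of the ribbon surface that runs along the left side of
  \<open>d\<close>, when \<open>d\<close> is followed away from its vertex.
\<close>

definition face :: "('v, 'd) dessin \<Rightarrow> 'd \<Rightarrow> 'd set" where
  "face D d = orbit (inv_into UNIV (nxt D) \<circ> opp D) d"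

definition isolated_verts :: "('v, 'd) dessin \<Rightarrow> 'v set" where
  "isolated_verts D = verts D - vtx D ` darts D"

definition same_component :: "('v, 'd) dessin \<Rightarrow> ('v \<times> 'v) set" where
  "same_component D =
     {(u, w). u \<in> verts D \<and> w \<in> verts D \<and>
              (u, w) \<in> {(vtx D d, vtx D (opp D d)) | d. d \<in> darts D}\<^sup>*}"

definition num_verts :: "('v, 'd) dessin \<Rightarrow> nat" where
  "num_verts D = card (verts D)"

definition num_edges :: "('v, 'd) dessin \<Rightarrow> nat" where
  "num_edges D = card (edges D)"

definition num_faces :: "('v, 'd) dessin \<Rightarrow> nat" where
  "num_faces D = card (face D ` darts D) + card (isolated_verts D)"

definition num_components :: "('v, 'd) dessin \<Rightarrow> nat" where
  "num_components D = card (verts D // same_component D)"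

definition connected_dessin :: "('v, 'd) dessin \<Rightarrow> bool" where
  "connected_dessin D \<longleftrightarrow> num_components D = 1"

definition genus :: "('v, 'd) dessin \<Rightarrow> rat" where
  "genus D =
     (2 * of_nat (num_components D) - of_nat (num_verts D) + of_nat (num_edges D)
        - of_nat (num_faces D)) / 2"

definition dessin_iso :: "('v, 'd) dessin \<Rightarrow> ('w, 'c) dessin \<Rightarrow> bool" where
  "dessin_iso D D' \<longleftrightarrow>
     (\<exists>f g. bij_betw f (verts D) (verts D') \<and> bij_betw g (darts D) (darts D') \<and>
        (\<forall>d\<in>darts D. vtx D' (g d) = f (vtx D d) \<and> nxt D' (g d) = g (nxt D d) \<and>
                     opp D' (g d) = g (opp D d)))"


section \<open>Spanning quasi-trees\<close>

definition first_return :: "('a \<Rightarrow> 'a) \<Rightarrow> 'a set \<Rightarrow> 'a \<Rightarrow> 'a" where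
  "first_return f S x = (f ^^ (LEAST n. 0 < n \<and> (f ^^ n) x \<in> S)) x"

text \<open>The spanning sub-dessin with edge set \<open>F\<close>; \<open>F\<close> is meant to be a subset of \<open>edges D\<close>.\<close>

definition spanning_sub :: "('v, 'd) dessin \<Rightarrow> 'd set set \<Rightarrow> ('v, 'd) dessin" where
  "spanning_sub D F =
     \<lparr> verts = verts D,
       darts = \<Union>F,
       vtx = vtx D,
       nxt = (\<lambda>d. if d \<in> \<Union>F then first_return (nxt D) (\<Union>F) d else d),
       opp = (\<lambda>d. if d \<in> \<Union>F then opp D d else d) \<rparr>"

definition quasi_tree :: "nat \<Rightarrow> ('v, 'd) dessin \<Rightarrow> bool" where
  "quasi_tree j H \<longleftrightarrow>
     connected_dessin H \<and> genus H = of_nat j \<and> num_faces H = 1 \<and>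
     num_edges H + 1 = num_verts H + 2 * j"

definition num_quasi_trees :: "nat \<Rightarrow> ('v, 'd) dessin \<Rightarrow> nat" where
  "num_quasi_trees j D = card {F. F \<subseteq> edges D \<and> quasi_tree j (spanning_sub D F)}"


section \<open>Chord diagrams and the intersection matrix\<close>

text \<open>
  For a one-vertex dessin, the chords are the edges and the darts are the chord endpoints on the
  circle. A base point is given by the first endpoint \<open>b\<close> that is met after it; if there are no
  chords, \<open>b\<close> plays no role.
\<close>

definition base_dart :: "('v, 'd) dessin \<Rightarrow> 'd \<Rightarrow> bool" where
  "base_dart D b \<longleftrightarrow> (darts D \<noteq> {} \<longrightarrow> b \<in> darts D)"

definition position :: "('v, 'd) dessin \<Rightarrow> 'd \<Rightarrow> 'd \<Rightarrow> nat" where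
  "position D b d = (LEAST n. (nxt D ^^ n) b = d)"

definition first_met :: "('v, 'd) dessin \<Rightarrow> 'd \<Rightarrow> 'd set \<Rightarrow> nat" where
  "first_met D b c = Min (position D b ` c)"

definition last_met :: "('v, 'd) dessin \<Rightarrow> 'd \<Rightarrow> 'd set \<Rightarrow> nat" where
  "last_met D b c = Max (position D b ` c)"

text \<open>Chords are numbered from 0.\<close>

definition chord :: "('v, 'd) dessin \<Rightarrow> 'd \<Rightarrow> nat \<Rightarrow> 'd set" where
  "chord D b i =
     (THE c. c \<in> edges D \<and> card {c' \<in> edges D. first_met D b c' < first_met D b c} = i)"

definition chords_intersect :: "('v, 'd) dessin \<Rightarrow> 'd \<Rightarrow> 'd set \<Rightarrow> 'd set \<Rightarrow> bool" where
  "chords_intersect D b c c' \<longleftrightarrow>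
     first_met D b c < first_met D b c' \<and> first_met D b c' < last_met D b c \<and>
       last_met D b c < last_met D b c' \<or>
     first_met D b c' < first_met D b c \<and> first_met D b c < last_met D b c' \<and>
       last_met D b c' < last_met D b c"

definition IM :: "('v, 'd) dessin \<Rightarrow> 'd \<Rightarrow> int mat" where
  "IM D b = mat (num_edges D) (num_edges D) (\<lambda>(i, j).
     if chords_intersect D b (chord D b i) (chord D b j) then sgn (int i - int j) else 0)"


section \<open>Connected link diagrams\<close>

text \<open>
  The projection is a plane graph, i.e. a connected dessin of genus 0 whose cyclic orders
  are counterclockwise in the plane. Its vertices of valence 4 are the crossings. Vertices of
  valence 2 are mere marker points on a strand, without any meaning for the link; they are
  admitted so that the diagram without crossings (a single circle) is covered. \<open>over\<close> consists
  of the darts at crossings that belong to the over-strand, and \<open>outer\<close> is a dart that has the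
  unbounded region of the plane on its left when it is followed away from its vertex.
\<close>

record ('v, 'd) link_diagram =
  projection :: "('v, 'd) dessin"
  over :: "'d set"
  outer :: 'd

definition valence :: "('v, 'd) dessin \<Rightarrow> 'v \<Rightarrow> nat" where
  "valence D v = card {d \<in> darts D. vtx D d = v}"

definition crossings :: "('v, 'd) link_diagram \<Rightarrow> 'v set" where
  "crossings P = {v \<in> verts (projection P). valence (projection P) v = 4}"

definition crossing_darts :: "('v, 'd) link_diagram \<Rightarrow> 'd set" where
  "crossing_darts P = {d \<in> darts (projection P). vtx (projection P) d \<in> crossings P}"

definition connected_link_diagram :: "('v, 'd) link_diagram \<Rightarrow> bool" where
  "connected_link_diagram P \<longleftrightarrow>
     dessin (projection P) \<and> connected_dessin (projection P) \<and> genus (projection P) = 0 \<and>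
     (\<forall>v\<in>verts (projection P). valence (projection P) v \<in> {2, 4}) \<and>
     over P \<subseteq> crossing_darts P \<and>
     (\<forall>d\<in>crossing_darts P. d \<in> over P \<longleftrightarrow> nxt (projection P) d \<notin> over P) \<and>
     outer P \<in> darts (projection P)"


section \<open>States and the all-A dessin\<close>

text \<open>
  A state is given by the set \<open>S\<close> of crossings that receive the B-splicing. After splicing, a
  strand that arrives at a vertex along the dart \<open>d\<close> leaves it along \<open>splice P S d\<close>. Rotating an
  over-dart \<open>d\<close> counterclockwise onto the under-strand sweeps out the corner between \<open>d\<close> and
  \<open>nxt d\<close>, so the A-splicing, which opens this corner, connects \<open>d\<close> with its predecessor.
\<close>

definition splice :: "('v, 'd) link_diagram \<Rightarrow> 'v set \<Rightarrow> 'd \<Rightarrow> 'd" where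
  "splice P S d =
     (if d \<in> crossing_darts P \<and> (d \<in> over P \<longleftrightarrow> vtx (projection P) d \<notin> S)
      then inv_into UNIV (nxt (projection P)) d
      else nxt (projection P) d)"

definition state_circle :: "('v, 'd) link_diagram \<Rightarrow> 'v set \<Rightarrow> 'd \<Rightarrow> 'd set" where
  "state_circle P S d =
     {d'. (d, d') \<in> ({(x, opp (projection P) x) | x. x \<in> darts (projection P)} \<union>
                     {(x, splice P S x) | x. x \<in> darts (projection P)})\<^sup>*}"

definition state_circles :: "('v, 'd) link_diagram \<Rightarrow> 'v set \<Rightarrow> 'd set set" where
  "state_circles P S = state_circle P S ` darts (projection P)"

text \<open>
  \<open>interior_regions P C\<close> is the set of regions of the projection that lie inside the all-A circle
  \<open>C\<close>: those that cannot be joined to the unbounded region without meeting \<open>C\<close>. A path avoiding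
  \<open>C\<close> may pass through the opened corners at a crossing, and across any edge not on \<open>C\<close>.
\<close>

definition region_adj :: "('v, 'd) link_diagram \<Rightarrow> 'd set \<Rightarrow> ('d set \<times> 'd set) set" where
  "region_adj P C =
     {(face (projection P) x, face (projection P) (opp (projection P) x)) | x.
        x \<in> darts (projection P) - C} \<union>
     {(face (projection P) x, face (projection P) (nxt (projection P) (nxt (projection P) x))) | x.
        x \<in> over P}"

definition interior_regions :: "('v, 'd) link_diagram \<Rightarrow> 'd set \<Rightarrow> 'd set set" where
  "interior_regions P C =
     {R \<in> face (projection P) ` darts (projection P).
        (face (projection P) (outer P), R) \<notin> (region_adj P C)\<^sup>*}"

definition lies_inside :: "('v, 'd) link_diagram \<Rightarrow> 'd set \<Rightarrow> 'd set \<Rightarrow> bool" where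
  "lies_inside P C' C \<longleftrightarrow> C' \<noteq> C \<and> face (projection P) ` C' \<subseteq> interior_regions P C"

definition depth :: "('v, 'd) link_diagram \<Rightarrow> 'd set \<Rightarrow> nat" where
  "depth P C' = card {C \<in> state_circles P {}. lies_inside P C' C}"

text \<open>
  A circle is oriented anti-clockwise (interior on the left) if its depth is even and clockwise
  (interior on the right) if its depth is odd. \<open>inward P x\<close> says that this orientation follows
  the edge of \<open>x\<close> towards the vertex of \<open>x\<close>; the region on the left is then the one on the left
  of \<open>opp x\<close>.
\<close>

definition inward :: "('v, 'd) link_diagram \<Rightarrow> 'd \<Rightarrow> bool" where
  "inward P x \<longleftrightarrow>
     (even (depth P (state_circle P {} x)) \<longleftrightarrow>
      face (projection P) (opp (projection P) x) \<in> interior_regions P (state_circle P {} x))"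

text \<open>
  At a crossing, each of the two strands of the A-splicing contains exactly one over-dart, so
  the arc-ends are represented by the over-darts. \<open>arrival P d\<close> is the dart along which the
  oriented circle arrives at the arc-end \<open>d\<close>, and \<open>arc_end P\<close> maps either dart of a spliced
  strand back to the arc-end on it.
\<close>

definition arrival :: "('v, 'd) link_diagram \<Rightarrow> 'd \<Rightarrow> 'd" where
  "arrival P d = (if inward P d then d else splice P {} d)"

definition arc_end :: "('v, 'd) link_diagram \<Rightarrow> 'd \<Rightarrow> 'd" where
  "arc_end P x = (if x \<in> over P then x else splice P {} x)"

definition next_arc_end :: "('v, 'd) link_diagram \<Rightarrow> 'd \<Rightarrow> 'd" where
  "next_arc_end P d =
     arc_end P (first_return (opp (projection P) \<circ> splice P {}) (crossing_darts P) (arrival P d))"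

definition all_A_dessin :: "('v, 'd) link_diagram \<Rightarrow> ('d set, 'd) dessin" where
  "all_A_dessin P =
     \<lparr> verts = state_circles P {},
       darts = over P,
       vtx = state_circle P {},
       nxt = (\<lambda>d. if d \<in> over P then next_arc_end P d else d),
       opp = (\<lambda>d. if d \<in> over P then nxt (projection P) (nxt (projection P) d) else d) \<rparr>"


section \<open>Jones polynomial and determinant of a link\<close>

text \<open>
  Kauffman's bracket, normalised to 1 on the circle; \<open>A\<close> ranges over the nonzero complex numbers.
\<close>

definition kauffman_bracket :: "('v, 'd) link_diagram \<Rightarrow> complex \<Rightarrow> complex" where
  "kauffman_bracket P A =
     (\<Sum>S\<in>Pow (crossings P).
        A powi (int (card (crossings P - S)) - int (card S)) *
        (- (A powi 2) - A powi (-2)) ^ (card (state_circles P S) - 1))"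

text \<open>
  An orientation of the link is given by the set \<open>Out\<close> of darts that are directed away from
  their vertex. Strands pass straight through a vertex: from a dart to the one half a turn
  further on.
\<close>

definition link_orientation :: "('v, 'd) link_diagram \<Rightarrow> 'd set \<Rightarrow> bool" where
  "link_orientation P Out \<longleftrightarrow>
     Out \<subseteq> darts (projection P) \<and>
     (\<forall>d\<in>darts (projection P).
        (d \<in> Out \<longleftrightarrow> opp (projection P) d \<notin> Out) \<and>
        (d \<in> Out \<longleftrightarrow>
          (nxt (projection P) ^^ (valence (projection P) (vtx (projection P) d) div 2)) d \<notin> Out))"

text \<open>
  A crossing is positive if the direction of the over-strand is turned counterclockwise onto
  the direction of the under-strand by a quarter turn.
\<close>

definition positive_crossing :: "('v, 'd) link_diagram \<Rightarrow> 'd set \<Rightarrow> 'v \<Rightarrow> bool" where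
  "positive_crossing P Out v \<longleftrightarrow>
     (\<exists>d\<in>over P \<inter> Out. vtx (projection P) d = v \<and> nxt (projection P) d \<in> Out)"

definition writhe :: "('v, 'd) link_diagram \<Rightarrow> 'd set \<Rightarrow> int" where
  "writhe P Out = (\<Sum>v\<in>crossings P. if positive_crossing P Out v then 1 else -1)"

text \<open>
  The Jones polynomial is a Laurent polynomial in the square root of \<open>t\<close>, obtained from the
  writhe-normalised bracket by \<open>t = A powi (-4)\<close>. It is evaluated with the principal branch of
  the roots; another branch changes the value at most by a sign.
\<close>

definition jones :: "('v, 'd) link_diagram \<Rightarrow> 'd set \<Rightarrow> complex \<Rightarrow> complex" where
  "jones P Out t =
     (let A = inverse (csqrt (csqrt t))
      in (- (A ^ 3)) powi (- writhe P Out) * kauffman_bracket P A)"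

definition link_det :: "('v, 'd) link_diagram \<Rightarrow> 'd set \<Rightarrow> real" where
  "link_det P Out = cmod (jones P Out (-1))"

end

theory Submission
  imports Defs
begin

text \<open>
  Expanding \<open>det (IM - x I)\<close> by principal minors reduces the first claim to the following: the minor
  of \<open>IM\<close> on a set \<open>F\<close> of chords is 1 if the sub-dessin with edge set \<open>F\<close> has one face, and 0
  otherwise. Let \<open>\<sigma>\<close> be the cyclic order of the chord ends and \<open>\<alpha>\<close> the involution that swaps the ends
  of the chords in \<open>F\<close> and fixes all other chord ends. The faces correspond to the cycles of
  \<open>\<sigma> \<circ> \<alpha>\<close>. Cutting \<open>\<sigma>\<close> at the base point turns its matrix into a nilpotent shift \<open>S\<close>, and
  \<open>det (1 - S \<alpha>)\<close> is 1 if \<open>\<sigma> \<circ> \<alpha>\<close> is a single cycle and 0 otherwise. Writing \<open>\<alpha> = 1 - V V\<^sup>T\<close>, the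
  identity \<open>det (1 + A B) = det (1 + B A)\<close> turns this determinant into the minor of \<open>IM\<close>.

  At \<open>t = -1\<close> the loop value of Kauffman's bracket vanishes, so only the states with a single circle
  contribute. If the all-A state is a single circle, it separates the plane, hence its orientation is
  coherent with all other splicings, and the circles of the state \<open>S\<close> correspond to the cycles of
  \<open>\<sigma> \<circ> \<alpha>\<close> for the set of chords given by \<open>S\<close>.
\<close>

section \<open>Transitive permutations\<close>

text \<open>Uncut, \<open>1\<close> minus the matrix of \<sigma> \<circ> \<alpha> is always
  singular, since it kills the all-ones vector. After the cut only cycles that avoid the base point
  give kernel vectors, and \<open>1 - S\<close> becomes invertible over the integers. The base point
  of the cut is the one that numbers the chords, so it also fixes the signs in \<open>IM\<close>:
  pairing \<open>e\<^sub>p - e\<^sub>q\<close> for two chords through the matrix of ones below the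
  diagonal gives 0 for nested or disjoint chords and 1 or -1 for interleaved ones.

  A sub-dessin has its cyclic order only on its own darts, as a first-return map, whereas the
  determinant sees all darts. The same gap separates the arc-ends of the all-A dessin from the darts
  of the projection. "Single cycle" is therefore encoded as the absence of proper non-empty
  invariant subsets, a notion that passes through conjugation, inversion and first returns without
  counting cycles. The empty set counts as transitive, in accordance with the single face of an
  isolated vertex and the empty determinant 1.

  That a single all-A circle has two sides is a Jordan curve statement; it is extracted from genus 0
  by counting regions.\<close>

definition transitive_on :: "('a \<Rightarrow> 'a) \<Rightarrow> 'a set \<Rightarrow> bool" where
  "transitive_on f X \<longleftrightarrow> (\<forall>Z\<subseteq>X. Z \<noteq> {} \<longrightarrow> f ` Z \<subseteq> Z \<longrightarrow> Z = X)"

lemma transitive_onI: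
  "(\<And>Z. Z \<subseteq> X \<Longrightarrow> Z \<noteq> {} \<Longrightarrow> (\<And>z. z \<in> Z \<Longrightarrow> f z \<in> Z) \<Longrightarrow> Z = X) \<Longrightarrow> transitive_on f X"
  unfolding transitive_on_def by blast

lemma transitive_onD:
  "transitive_on f X \<Longrightarrow> Z \<subseteq> X \<Longrightarrow> Z \<noteq> {} \<Longrightarrow> (\<And>z. z \<in> Z \<Longrightarrow> f z \<in> Z) \<Longrightarrow> Z = X"
  unfolding transitive_on_def by blast

lemma invariant_image_eq:
  assumes "finite X" "inj_on f X" "Z \<subseteq> X" "f ` Z \<subseteq> Z"
  shows "f ` Z = Z"
  using assms by (meson endo_inj_surj finite_subset inj_on_subset)

text \<open>By finiteness \<open>f\<close> maps \<open>Z\<close> onto itself, so injectivity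
  prevents any point outside from entering.\<close>

lemma invariant_complement:
  assumes "finite X" "bij_betw f X X" "Z \<subseteq> X" "\<And>z. z \<in> Z \<Longrightarrow> f z \<in> Z" "x \<in> X" "x \<notin> Z"
  shows "f x \<in> X" "f x \<notin> Z"
proof -
  have "inj_on f X" "f ` X = X" using assms(2) by (auto simp: bij_betw_def)
  then have "f ` Z = Z" using invariant_image_eq[OF assms(1) _ assms(3)] assms(4) by blast
  show "f x \<in> X" using \<open>f ` X = X\<close> assms(5) by blast
  show "f x \<notin> Z"
  proof
    assume "f x \<in> Z"
    then obtain z where "z \<in> Z" "f z = f x" using \<open>f ` Z = Z\<close> by (metis imageE)
    then have "z = x" using \<open>inj_on f X\<close> assms(3,5) by (meson inj_onD subsetD)
    then show False using \<open>z \<in> Z\<close> assms(6) by blast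
  qed
qed

lemma transitive_on_cong:
  assumes "\<And>x. x \<in> X \<Longrightarrow> f x = g x"
  shows "transitive_on f X \<longleftrightarrow> transitive_on g X"
proof -
  have "f ` Z = g ` Z" if "Z \<subseteq> X" for Z
    using assms that by (intro image_cong) auto
  then show ?thesis unfolding transitive_on_def by simp
qed

lemma transitive_on_bij:
  assumes h: "bij_betw h X Y" and f: "\<And>x. x \<in> X \<Longrightarrow> f x \<in> X"
    and comm: "\<And>x. x \<in> X \<Longrightarrow> g (h x) = h (f x)"
  shows "transitive_on f X \<longleftrightarrow> transitive_on g Y"
proof
  assume t: "transitive_on f X"
  show "transitive_on g Y"
  proof (rule transitive_onI)
    fix Z assume Z: "Z \<subseteq> Y" "Z \<noteq> {}" "\<And>z. z \<in> Z \<Longrightarrow> g z \<in> Z"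
    have "{x \<in> X. h x \<in> Z} = X"
    proof (rule transitive_onD[OF t])
      show "{x \<in> X. h x \<in> Z} \<noteq> {}" using Z(1,2) h unfolding bij_betw_def by blast
      show "f x \<in> {x \<in> X. h x \<in> Z}" if "x \<in> {x \<in> X. h x \<in> Z}" for x
        using that f comm Z(3)[of "h x"] by auto
    qed auto
    then have "h ` X \<subseteq> Z" by blast
    then show "Z = Y" using Z(1) h by (auto simp: bij_betw_def)
  qed
next
  assume t: "transitive_on g Y"
  show "transitive_on f X"
  proof (rule transitive_onI)
    fix Z assume Z: "Z \<subseteq> X" "Z \<noteq> {}" "\<And>z. z \<in> Z \<Longrightarrow> f z \<in> Z"
    have "h ` Z = Y"
    proof (rule transitive_onD[OF t])
      show "h ` Z \<subseteq> Y" using Z(1) h unfolding bij_betw_def by blast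
      show "h ` Z \<noteq> {}" using Z by blast
      show "g y \<in> h ` Z" if "y \<in> h ` Z" for y
        using that Z comm by auto
    qed
    then show "Z = X"
      by (metis Z(1) bij_betw_def h inj_on_image_eq_iff order_refl)
  qed
qed

text \<open>On a finite set every invariant subset is mapped onto itself, so a permutation and its
  inverse have the same invariant subsets. Needed because faces are defined through the inverse of
  the cyclic order.\<close>

lemma transitive_on_inverse:
  assumes "finite X" "bij_betw f X X" "\<And>x. x \<in> X \<Longrightarrow> g (f x) = x"
  shows "transitive_on g X \<longleftrightarrow> transitive_on f X"
proof -
  have inj: "inj_on f X" and im: "f ` X = X" using assms(2) by (auto simp: bij_betw_def)
  have "f ` Z \<subseteq> Z \<longleftrightarrow> g ` Z \<subseteq> Z" if Z: "Z \<subseteq> X" for Z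
  proof
    assume "f ` Z \<subseteq> Z"
    then have "f ` Z = Z" using invariant_image_eq[OF assms(1) inj Z] by blast
    then have "g ` Z = g ` f ` Z" by simp
    also have "\<dots> = Z" using assms(3) Z by (force simp: image_iff)
    finally show "g ` Z \<subseteq> Z" by simp
  next
    assume g: "g ` Z \<subseteq> Z"
    have "inj_on g X"
      by (subst im[symmetric]) (auto intro!: inj_onI simp: assms(3))
    then have "g ` Z = Z" using invariant_image_eq[OF assms(1) _ Z] g by blast
    then have "f ` Z = f ` g ` Z" by simp
    also have "\<dots> = Z"
    proof -
      have "f (g z) = z" if "z \<in> Z" for z
        using that Z im assms(3) by (metis imageE subsetD)
      then show ?thesis by (force simp: image_iff)
    qed
    finally show "f ` Z \<subseteq> Z" by simp
  qed
  then show ?thesis unfolding transitive_on_def by auto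
qed

text \<open>The map \<open>a\<close> itself conjugates \<open>f \<circ> a\<close> to
  \<open>a \<circ> f\<close>.\<close>

lemma transitive_on_conj_involution:
  assumes "bij_betw a X X" "\<And>x. x \<in> X \<Longrightarrow> f x \<in> X"
  shows "transitive_on (f \<circ> a) X \<longleftrightarrow> transitive_on (a \<circ> f) X"
  using assms by (intro transitive_on_bij[of a]) (auto simp: bij_betw_def)

lemma card_orbits_eq_1_iff:
  assumes "finite X" "X \<noteq> {}" "bij_betw f X X"
  shows "card (orbit f ` X) = 1 \<longleftrightarrow> transitive_on f X"
proof -
  have inj: "inj_on f X" and im: "f ` X = X" using assms(3) by (auto simp: bij_betw_def)
  have sub: "orbit f x \<subseteq> X" if "x \<in> X" for x
  proof
    fix y assume "y \<in> orbit f x"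
    then show "y \<in> X" by induct (use that im in auto)
  qed
  \<comment> \<open>\<open>orbit f x\<close> starts at \<open>f x\<close>; that it comes back to
    \<open>x\<close> is due to finiteness.\<close>
  have self: "x \<in> orbit f x" if "x \<in> X" for x
  proof -
    have "f ` orbit f x \<subseteq> orbit f x" by (auto intro: orbit.intros)
    then have "f ` orbit f x = orbit f x"
      by (rule invariant_image_eq[OF assms(1) inj sub[OF that]])
    then obtain y where "y \<in> orbit f x" "f y = f x"
      using orbit.base[of f x] by (metis imageE)
    then show ?thesis using inj sub[OF that] that by (metis inj_onD subsetD)
  qed
  show ?thesis
  proof
    assume "card (orbit f ` X) = 1"
    then obtain O' where O': "orbit f ` X = {O'}" by (auto simp: card_1_singleton_iff)
    have all: "orbit f x = X" if "x \<in> X" for x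
    proof
      have "orbit f y = orbit f x" if "y \<in> X" for y
        using O' that \<open>x \<in> X\<close> by (metis image_eqI singletonD)
      then show "X \<subseteq> orbit f x" using self by blast
    qed (rule sub[OF that])
    show "transitive_on f X"
    proof (rule transitive_onI)
      fix Z assume Z: "Z \<subseteq> X" "Z \<noteq> {}" "\<And>z. z \<in> Z \<Longrightarrow> f z \<in> Z"
      then obtain z where z: "z \<in> Z" by blast
      have "y \<in> Z" if "y \<in> orbit f z" for y
        using that by induct (use z Z in auto)
      then show "Z = X" using all z Z(1) by blast
    qed
  next
    assume t: "transitive_on f X"
    have "orbit f x = X" if "x \<in> X" for x
      by (rule transitive_onD[OF t]) (use sub[OF that] self[OF that] in \<open>auto intro: orbit.intros\<close>)
    then have "orbit f ` X = {X}" using assms(2) by auto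
    then show "card (orbit f ` X) = 1" by simp
  qed
qed

section \<open>First returns to a subset\<close>

lemma first_return_eq:
  assumes "0 < n" "(f ^^ n) x \<in> S" "\<And>j. 0 < j \<Longrightarrow> j < n \<Longrightarrow> (f ^^ j) x \<notin> S"
  shows "first_return f S x = (f ^^ n) x"
proof -
  have "(LEAST n. 0 < n \<and> (f ^^ n) x \<in> S) = n"
    using assms by (intro Least_equality) (auto simp: not_less[symmetric])
  then show ?thesis by (simp add: first_return_def)
qed

lemma first_return_ex:
  assumes "0 < k" "(f ^^ k) x \<in> S"
  shows "\<exists>n>0. first_return f S x = (f ^^ n) x \<and> (f ^^ n) x \<in> S \<and>
    (\<forall>j. 0 < j \<longrightarrow> j < n \<longrightarrow> (f ^^ j) x \<notin> S)"
proof -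
  define n where "n = (LEAST n. 0 < n \<and> (f ^^ n) x \<in> S)"
  have "0 < n \<and> (f ^^ n) x \<in> S"
    unfolding n_def by (rule LeastI[of _ k]) (use assms in auto)
  moreover have "(f ^^ j) x \<notin> S" if "0 < j" "j < n" for j
    using not_less_Least[of j "\<lambda>n. 0 < n \<and> (f ^^ n) x \<in> S"] that by (auto simp: n_def)
  moreover have "first_return f S x = (f ^^ n) x" by (simp add: first_return_def n_def)
  ultimately show ?thesis by blast
qed

lemma transitive_on_orbit_eq:
  assumes "transitive_on f X" "\<And>x. x \<in> X \<Longrightarrow> f x \<in> X" "x \<in> X"
  shows "orbit f x = X"
proof (rule transitive_onD[OF assms(1)])
  show "orbit f x \<subseteq> X"
  proof
    fix y assume "y \<in> orbit f x"
    then show "y \<in> X" by induct (use assms in auto)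
  qed
qed (auto intro: orbit.intros)

lemma transitive_on_returns:
  assumes "transitive_on f X" "\<And>x. x \<in> X \<Longrightarrow> f x \<in> X" "x \<in> X" "y \<in> X"
  shows "\<exists>k>0. (f ^^ k) x = y"
  using transitive_on_orbit_eq[OF assms(1-3)] assms(4) by (auto simp: orbit_altdef)

text \<open>The iterates before the least return time are distinct and exhaust the orbit, so that
  time equals the size of the orbit.\<close>

lemma orbit_period:
  assumes "x \<in> orbit f x"
  shows "bij_betw (\<lambda>k. (f ^^ k) x) {0..<card (orbit f x)} (orbit f x)"
    and "(f ^^ card (orbit f x)) x = x"
proof -
  let ?n = "funpow_dist1 f x x"
  have n: "(f ^^ ?n) x = x" using funpow_dist1_prop[OF assms] by simp
  have "inj_on (\<lambda>k. (f ^^ k) x) {0..<?n}" by (rule inj_on_funpow_dist1[OF assms])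
  moreover have "orbit f x = (\<lambda>k. (f ^^ k) x) ` {0..<?n}" by (rule orbit_conv_funpow_dist1[OF assms])
  ultimately have bij: "bij_betw (\<lambda>k. (f ^^ k) x) {0..<?n} (orbit f x)" by (simp add: bij_betw_def)
  then have "card (orbit f x) = ?n" using bij_betw_same_card[OF bij] by simp
  then show "bij_betw (\<lambda>k. (f ^^ k) x) {0..<card (orbit f x)} (orbit f x)"
    and "(f ^^ card (orbit f x)) x = x" using bij n by simp_all
qed

text \<open>Outside of \<open>Y\<close> the map \<open>f \<circ> \<kappa>\<close> agrees with
  \<open>f\<close>, so between two visits to \<open>Y\<close> it merely follows \<open>f\<close>,
  and its first-return map on \<open>Y\<close> is \<open>first_return f Y \<circ> \<kappa>\<close>.
  No cycle of \<open>f \<circ> \<kappa>\<close> can miss \<open>Y\<close>, since it would be a cycle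
  of the transitive \<open>f\<close>.\<close>

lemma transitive_on_first_return:
  assumes fin: "finite X" and f: "bij_betw f X X" and t: "transitive_on f X"
    and Y: "Y \<subseteq> X" "Y \<noteq> {}" and \<kappa>: "bij_betw \<kappa> Y Y" and id: "\<And>x. x \<in> X - Y \<Longrightarrow> \<kappa> x = x"
  shows "transitive_on (f \<circ> \<kappa>) X \<longleftrightarrow> transitive_on (first_return f Y \<circ> \<kappa>) Y"
proof -
  have fX: "f x \<in> X" if "x \<in> X" for x using f that by (auto simp: bij_betw_def)
  have \<kappa>Y: "\<kappa> x \<in> Y" if "x \<in> Y" for x using \<kappa> that by (auto simp: bij_betw_def)
  have "bij_betw \<kappa> (X - Y) (X - Y)" using id by (simp add: bij_betw_def inj_on_def)
  then have "bij_betw \<kappa> (Y \<union> (X - Y)) (Y \<union> (X - Y))"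
    by (rule bij_betw_combine[OF \<kappa>]) auto
  moreover have "Y \<union> (X - Y) = X" using Y by blast
  ultimately have \<kappa>X: "bij_betw \<kappa> X X" by simp
  then have f\<kappa>: "bij_betw (f \<circ> \<kappa>) X X" using f by (rule bij_betw_trans)
  have powX: "(f ^^ k) x \<in> X" if "x \<in> X" for x k by (induct k) (use that fX in auto)
  have ret: "\<exists>k>0. (f ^^ k) x \<in> Y" if "x \<in> X" for x
    using transitive_on_returns[OF t fX that] Y by (metis ex_in_conv subsetD)
  show ?thesis
  proof
    assume t': "transitive_on (f \<circ> \<kappa>) X"
    show "transitive_on (first_return f Y \<circ> \<kappa>) Y"
    proof (rule transitive_onI)
      fix Z assume Z: "Z \<subseteq> Y" "Z \<noteq> {}" "\<And>z. z \<in> Z \<Longrightarrow> (first_return f Y \<circ> \<kappa>) z \<in> Z"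
      \<comment> \<open>The runs of \<open>f\<close> that start behind a point
        \<open>\<kappa> z\<close> and extend up to and including the next visit to
        \<open>Y\<close>.\<close>
      define Z' where "Z' = {(f ^^ k) (\<kappa> z) | k z. z \<in> Z \<and> 0 < k \<and>
        (\<forall>j. 0 < j \<longrightarrow> j < k \<longrightarrow> (f ^^ j) (\<kappa> z) \<notin> Y)}"
      have start: "f (\<kappa> z) \<in> Z'" if "z \<in> Z" for z
        unfolding Z'_def using that by (auto intro!: exI[of _ "Suc 0"] exI[of _ z])
      have backZ: "w \<in> Z" if "w \<in> Z'" "w \<in> Y" for w
      proof -
        obtain k z where k: "w = (f ^^ k) (\<kappa> z)" "z \<in> Z" "0 < k"
          "\<forall>j. 0 < j \<longrightarrow> j < k \<longrightarrow> (f ^^ j) (\<kappa> z) \<notin> Y"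
          using \<open>w \<in> Z'\<close> by (auto simp: Z'_def)
        then have "first_return f Y (\<kappa> z) = w"
          using \<open>w \<in> Y\<close> by (subst first_return_eq[of k]) auto
        then show ?thesis using Z(3)[OF k(2)] by simp
      qed
      have "Z' = X"
      proof (rule transitive_onD[OF t'])
        show sub: "Z' \<subseteq> X"
        proof
          fix w assume "w \<in> Z'"
          then obtain k z where "w = (f ^^ k) (\<kappa> z)" "z \<in> Z" by (auto simp: Z'_def)
          then show "w \<in> X" using powX[of "\<kappa> z" k] \<kappa>Y[of z] Z(1) Y(1) by blast
        qed
        show "Z' \<noteq> {}" using start Z(2) by blast
        show "(f \<circ> \<kappa>) w \<in> Z'" if w: "w \<in> Z'" for w
        proof (cases "w \<in> Y")
          case True
          then show ?thesis using start backZ w by simp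
        next
          case False
          obtain k z where k: "w = (f ^^ k) (\<kappa> z)" "z \<in> Z" "0 < k"
            "\<forall>j. 0 < j \<longrightarrow> j < k \<longrightarrow> (f ^^ j) (\<kappa> z) \<notin> Y"
            using w by (auto simp: Z'_def)
          have "f w = (f ^^ Suc k) (\<kappa> z)" using k by simp
          moreover have "\<forall>j. 0 < j \<longrightarrow> j < Suc k \<longrightarrow> (f ^^ j) (\<kappa> z) \<notin> Y"
            using k False by (auto simp: less_Suc_eq)
          ultimately have "f w \<in> Z'" unfolding Z'_def using k(2) by blast
          moreover have "\<kappa> w = w" using id False w sub by blast
          ultimately show ?thesis by simp
        qed
      qed
      then show "Z = Y" using backZ Z(1) Y(1) by blast
    qed
  next
    assume t': "transitive_on (first_return f Y \<circ> \<kappa>) Y"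
    have meet: "Z \<inter> Y \<noteq> {}" if Z: "Z \<subseteq> X" "Z \<noteq> {}" "\<And>z. z \<in> Z \<Longrightarrow> (f \<circ> \<kappa>) z \<in> Z" for Z
    proof
      assume Z0: "Z \<inter> Y = {}"
      then have "f z \<in> Z" if "z \<in> Z" for z
        using Z(3)[OF that] id[of z] Z(1) Z0 that by (metis Diff_iff IntI comp_apply empty_iff subsetD)
      then have "Z = X" by (rule transitive_onD[OF t Z(1,2)])
      then show False using Z0 Y by blast
    qed
    show "transitive_on (f \<circ> \<kappa>) X"
    proof (rule transitive_onI)
      fix Z assume Z: "Z \<subseteq> X" "Z \<noteq> {}" "\<And>z. z \<in> Z \<Longrightarrow> (f \<circ> \<kappa>) z \<in> Z"
      have "Z \<inter> Y = Y"
      proof (rule transitive_onD[OF t'])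
        show "Z \<inter> Y \<noteq> {}" by (rule meet[OF Z])
        show "(first_return f Y \<circ> \<kappa>) z \<in> Z \<inter> Y" if z: "z \<in> Z \<inter> Y" for z
        proof -
          have "\<kappa> z \<in> X" using z \<kappa>Y Y by blast
          with ret obtain k where "0 < k" "(f ^^ k) (\<kappa> z) \<in> Y" by blast
          then obtain n where n: "0 < n" "first_return f Y (\<kappa> z) = (f ^^ n) (\<kappa> z)" "(f ^^ n) (\<kappa> z) \<in> Y"
            "\<forall>j. 0 < j \<longrightarrow> j < n \<longrightarrow> (f ^^ j) (\<kappa> z) \<notin> Y"
            using first_return_ex by metis
          have "(f ^^ Suc j) (\<kappa> z) \<in> Z" if "j < n" for j
            using that
          proof (induct j)
            case 0
            then show ?case using Z(3)[of z] z by simp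
          next
            case (Suc j)
            then have "(f ^^ Suc j) (\<kappa> z) \<in> Z" "(f ^^ Suc j) (\<kappa> z) \<notin> Y" using n(4) by auto
            then show ?case using Z(3)[of "(f ^^ Suc j) (\<kappa> z)"] id[of "(f ^^ Suc j) (\<kappa> z)"] Z(1) by auto
          qed
          from this[of "n - 1"] show ?thesis using n by simp
        qed
      qed auto
      show "Z = X"
      proof (rule ccontr)
        assume "Z \<noteq> X"
        \<comment> \<open>The complement of \<open>Z\<close> is invariant too, so it would also have
          to meet \<open>Y\<close>.\<close>
        then have "(X - Z) \<inter> Y \<noteq> {}"
          using invariant_complement[OF fin f\<kappa> Z(1,3)] Z(1) by (intro meet) auto
        then show False using \<open>Z \<inter> Y = Y\<close> by blast
      qed
    qed
  qed
qed

text \<open>If \<open>x\<close> and \<open>y\<close> return to the same point after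
  \<open>n \<le> m\<close> steps, cancelling \<open>n\<close> steps gives
  \<open>x = (f ^^ (m - n)) y\<close>. Unless \<open>m = n\<close>, this is a visit of
  \<open>y\<close> to \<open>Y\<close> before its first return.\<close>

lemma bij_betw_first_return:
  assumes fin: "finite X" and inj: "inj f" and fX: "\<And>x. x \<in> X \<Longrightarrow> f x \<in> X"
    and t: "transitive_on f X" and Y: "Y \<subseteq> X"
  shows "bij_betw (first_return f Y) Y Y"
proof -
  have *: "\<exists>n>0. first_return f Y x = (f ^^ n) x \<and> (f ^^ n) x \<in> Y \<and> (\<forall>j. 0 < j \<longrightarrow> j < n \<longrightarrow> (f ^^ j) x \<notin> Y)"
    if "x \<in> Y" for x
  proof -
    have "x \<in> X" using that Y by blast
    then obtain k where "0 < k" "(f ^^ k) x = x" using transitive_on_returns[OF t fX, of x x] by auto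
    then show ?thesis using first_return_ex[of k f x Y] that by simp
  qed
  have aux: "x = y" if x: "x \<in> Y" and y: "y \<in> Y" and n: "0 < n" "(f ^^ n) x = (f ^^ m) y" "n \<le> m"
     "\<forall>j. 0 < j \<longrightarrow> j < m \<longrightarrow> (f ^^ j) y \<notin> Y" for x y n m
  proof -
    have "(f ^^ n) x = (f ^^ n) ((f ^^ (m - n)) y)"
      using n(2,3) by (metis comp_apply funpow_add le_add_diff_inverse)
    then have "x = (f ^^ (m - n)) y" by (rule injD[OF inj_fn[OF inj]])
    then show ?thesis using n x by (cases "m - n = 0") auto
  qed
  have "inj_on (first_return f Y) Y"
  proof (rule inj_onI)
    fix x y assume xy: "x \<in> Y" "y \<in> Y" "first_return f Y x = first_return f Y y"
    obtain n m where "n > 0" "m > 0" "(f ^^ n) x = (f ^^ m) y"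
      "\<forall>j. 0 < j \<longrightarrow> j < n \<longrightarrow> (f ^^ j) x \<notin> Y" "\<forall>j. 0 < j \<longrightarrow> j < m \<longrightarrow> (f ^^ j) y \<notin> Y"
      using *[OF xy(1)] *[OF xy(2)] xy(3) by auto
    then show "x = y" using aux[OF xy(1,2), of n m] aux[OF xy(2,1), of m n] by (cases "n \<le> m") auto
  qed
  moreover have "first_return f Y ` Y \<subseteq> Y" using * by (metis image_subsetI)
  ultimately show ?thesis
    using endo_inj_surj[OF finite_subset[OF Y fin]] by (simp add: bij_betw_def)
qed

section \<open>Determinants\<close>

text \<open>Sylvester's identity. The block matrix with rows \<open>(1, X)\<close> and
  \<open>(-Y, 1)\<close> is factored with the unipotent \<open>?L\<close> on the left and on the
  right; the two remaining factors are block triangular and carry the two Schur complements. No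
  division occurs.\<close>

lemma det_one_plus_mult_commute:
  fixes X Y :: "'a :: idom mat"
  assumes X: "X \<in> carrier_mat n k" and Y: "Y \<in> carrier_mat k n"
  shows "Determinant.det (1\<^sub>m n + X * Y) = Determinant.det (1\<^sub>m k + Y * X)"
proof -
  let ?M = "four_block_mat (1\<^sub>m n) X (- Y) (1\<^sub>m k)"
  let ?L = "four_block_mat (1\<^sub>m n) (0\<^sub>m n k) (- Y) (1\<^sub>m k)"
  have YX: "- Y * X + (1\<^sub>m k + Y * X) = 1\<^sub>m k"
    using X Y by (intro eq_matI) (auto simp: uminus_scalar_prod[symmetric])
  have XY: "1\<^sub>m n + X * Y + X * - Y = 1\<^sub>m n"
    using X Y by (intro eq_matI) auto
  have 1: "?L * four_block_mat (1\<^sub>m n) X (0\<^sub>m k n) (1\<^sub>m k + Y * X) = ?M"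
    using X Y YX
    by (subst mult_four_block_mat[of _ n n _ k _ k]) auto
  have 2: "four_block_mat (1\<^sub>m n + X * Y) X (0\<^sub>m k n) (1\<^sub>m k) * ?L = ?M"
    using X Y XY
    by (subst mult_four_block_mat[of _ n n _ k _ k]) auto
  have L: "Determinant.det ?L = 1"
    using Y by (subst det_four_block_mat_upper_right_zero[of _ n _ k]) auto
  have "Determinant.det ?M = Determinant.det (1\<^sub>m k + Y * X)"
    unfolding 1[symmetric] using X Y
    by (subst det_mult[of _ "n + k"], force, force, subst L,
        subst det_four_block_mat_lower_left_zero[of _ n _ k]) auto
  moreover have "Determinant.det ?M = Determinant.det (1\<^sub>m n + X * Y)"
    unfolding 2[symmetric] using X Y
    by (subst det_mult[of _ "n + k"], force, force, subst L,
        subst det_four_block_mat_lower_left_zero[of _ n _ k]) auto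
  ultimately show ?thesis by simp
qed

text \<open>Deleting row \<open>0\<close> cuts the cycle of \<open>\<phi>\<close> through \<open>0\<close> open, so this cycle contributes a unipotent
  block, while the indicator vector of any other cycle lies in the kernel.\<close>

lemma det_one_minus_cut_permutation:
  assumes \<phi>: "bij_betw \<phi> {0..<N} {0..<N}"
  shows "Determinant.det (mat N N (\<lambda>(i, j). of_bool (i = j) - of_bool (0 < i \<and> j = \<phi> i)) :: int mat)
    = of_bool (transitive_on \<phi> {0..<N})" (is "Determinant.det ?Q = _")
proof (cases "transitive_on \<phi> {0..<N}")
  case True
  have Q: "?Q \<in> carrier_mat N N" by simp
  have terms: "signof \<pi> * (\<Prod>i = 0..<N. ?Q $$ (i, \<pi> i)) = of_bool (\<pi> = id)" 
    if \<pi>: "\<pi> permutes {0..<N}" for \<pi>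
  proof (cases "(\<Prod>i = 0..<N. ?Q $$ (i, \<pi> i)) = 0")
    case z: True
    have "\<pi> \<noteq> id"
    proof
      assume "\<pi> = id"
      with z obtain i where i: "i < N" "?Q $$ (i, i) = 0" by auto
      then have "0 < i" "\<phi> i = i" by (auto split: if_splits)
      then have "{i} = {0..<N}" using i by (intro transitive_onD[OF True]) auto
      then show False using \<open>0 < i\<close> i by auto
    qed
    then show ?thesis using z by simp
  next
    case nz: False
    have nz': "?Q $$ (i, \<pi> i) \<noteq> 0" if "i < N" for i
    proof
      assume "?Q $$ (i, \<pi> i) = 0"
      then have "(\<Prod>i = 0..<N. ?Q $$ (i, \<pi> i)) = 0" using that by (intro prod_zero) auto
      with nz show False by (rule notE)
    qed
    \<comment> \<open>A non-vanishing Leibniz term moves points only along \<phi>, and never the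
      point 0. The set of moved points is therefore \<phi>-invariant without being everything, hence
      empty: only the identity contributes.\<close>
    define Z where "Z = {i. i < N \<and> \<pi> i \<noteq> i}"
    have Zi: "0 < i \<and> \<pi> i = \<phi> i \<and> \<phi> i \<in> Z" if "i \<in> Z" for i
    proof -
      have i: "i < N" "\<pi> i \<noteq> i" using that by (auto simp: Z_def)
      have "\<pi> i < N" using \<pi> i by (metis atLeastLessThan_iff permutes_in_image zero_le)
      have "0 < i \<and> \<pi> i = \<phi> i" using nz'[OF i(1)] i \<open>\<pi> i < N\<close> by (simp split: if_splits)
      then have "0 < i" "\<pi> i = \<phi> i" by auto
      moreover have "\<pi> (\<pi> i) \<noteq> \<pi> i" using i(2) permutes_inj[OF \<pi>] by (metis injD)
      then have "\<phi> i \<in> Z" using \<open>\<pi> i < N\<close> \<open>\<pi> i = \<phi> i\<close> by (simp add: Z_def)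
      ultimately show ?thesis by simp
    qed
    have "Z = {}"
    proof (rule ccontr)
      assume "Z \<noteq> {}"
      have Z: "Z = {0..<N}"
      proof (rule transitive_onD[OF True _ \<open>Z \<noteq> {}\<close>])
        show "Z \<subseteq> {0..<N}" by (auto simp: Z_def)
        show "\<phi> z \<in> Z" if "z \<in> Z" for z using Zi[OF that] by blast
      qed
      have "0 \<in> Z" using \<open>Z \<noteq> {}\<close> unfolding Z by auto
      then show False using Zi by blast
    qed
    have id: "\<pi> = id"
    proof
      fix i show "\<pi> i = id i"
        using \<open>Z = {}\<close> \<pi> by (cases "i < N") (auto simp: Z_def permutes_def)
    qed
    have "?Q $$ (i, i) = 1" if "i < N" for i
      using nz'[OF that] that unfolding id by (simp split: if_splits)
    then have "(\<Prod>i = 0..<N. ?Q $$ (i, \<pi> i)) = 1" unfolding id by (intro prod.neutral) auto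
    then show ?thesis using id by simp
  qed
  have "Determinant.det ?Q = (\<Sum>\<pi> | \<pi> permutes {0..<N}. of_bool (\<pi> = id))"
    unfolding det_def'[OF Q] by (rule sum.cong) (use terms in auto)
  also have "\<dots> = 1"
    by (subst sum.remove[of _ id]) (auto simp: finite_permutations permutes_id)
  finally show ?thesis using True by simp
next
  case False
  then obtain Z0 where Z0: "Z0 \<subseteq> {0..<N}" "Z0 \<noteq> {}" "\<And>z. z \<in> Z0 \<Longrightarrow> \<phi> z \<in> Z0" "Z0 \<noteq> {0..<N}"
    unfolding transitive_on_def by blast
  note co = invariant_complement[OF _ \<phi> Z0(1,3)]
  \<comment> \<open>Either the invariant set or its complement avoids 0; the indicator vector of
    that one does not notice the missing entry in row 0.\<close>
  define Z where "Z = (if 0 \<in> Z0 then {0..<N} - Z0 else Z0)"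
  have Z: "Z \<subseteq> {0..<N}" "Z \<noteq> {}" "0 \<notin> Z" using Z0 by (auto simp: Z_def)
  have inv: "\<phi> i \<in> Z \<longleftrightarrow> i \<in> Z" if "i < N" for i
    using co[of i] Z0(3)[of i] that by (auto simp: Z_def)
  define v where "v = vec N (\<lambda>i. of_bool (i \<in> Z) :: int)"
  have "?Q *\<^sub>v v = 0\<^sub>v N"
  proof (rule eq_vecI)
    fix i assume "i < dim_vec (0\<^sub>v N :: int vec)"
    then have i: "i < N" by simp
    have fi: "\<phi> i < N" using \<phi> i by (auto simp: bij_betw_def)
    have "(?Q *\<^sub>v v) $ i = (\<Sum>j = 0..<N. (of_bool (i = j) - of_bool (0 < i \<and> j = \<phi> i)) * of_bool (j \<in> Z))"
      using i by (simp add: scalar_prod_def v_def)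
    also have "\<dots> = (\<Sum>j = 0..<N. (if j = i then of_bool (i \<in> Z) else 0)) - (\<Sum>j = 0..<N. if j = \<phi> i then of_bool (0 < i \<and> \<phi> i \<in> Z) else 0)"
      unfolding sum_subtractf[symmetric] by (rule sum.cong) auto
    also have "\<dots> = of_bool (i \<in> Z) - of_bool (0 < i \<and> \<phi> i \<in> Z)"
      using i fi by simp
    also have "\<dots> = 0" using inv[OF i] Z(3) by (cases "i = 0") auto
    finally show "(?Q *\<^sub>v v) $ i = 0\<^sub>v N $ i" using i by simp
  qed simp
  moreover have "v \<noteq> 0\<^sub>v N"
  proof
    assume v0: "v = 0\<^sub>v N"
    obtain i where "i \<in> Z" using Z by blast
    then have "v $ i = 1" "i < N" using Z by (auto simp: v_def)
    then show False using v0 by simp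
  qed
  ultimately have "Determinant.det ?Q = 0"
    by (subst det_0_iff_vec_prod_zero[of _ N]) (auto intro!: exI[of _ v] simp: v_def)
  then show ?thesis using False by simp
qed

text \<open>Outside of \<open>F\<close> the matrix is replaced by the identity matrix rather than deleted; this leaves the
  principal minor unchanged and avoids renumbering.\<close>

definition principal_mat :: "nat set \<Rightarrow> 'a :: comm_ring_1 mat \<Rightarrow> 'a mat" where
  "principal_mat F A = mat (dim_row A) (dim_col A)
     (\<lambda>(i, j). if i \<in> F \<and> j \<in> F then A $$ (i, j) else of_bool (i = j))"

lemma principal_mat_carrier [simp]:
  "A \<in> carrier_mat m n \<Longrightarrow> principal_mat F A \<in> carrier_mat m n"
  by (auto simp: principal_mat_def)

text \<open>Each Leibniz product is multiplied out, with \<open>F\<close> the set of rows that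
  contribute their entry of \<open>A\<close>. The other rows contribute \<open>y\<close> and force
  \<pi> to fix their index, so \<pi> preserves \<open>F\<close> and a Leibniz term of the minor on
  \<open>F\<close> remains.\<close>

lemma det_add_scaled_one:
  assumes A: "A \<in> carrier_mat m m"
  shows "Determinant.det (A + y \<cdot>\<^sub>m 1\<^sub>m m)
    = (\<Sum>F\<in>Pow {0..<m}. y ^ (m - card F) * Determinant.det (principal_mat F A))"
proof -
  let ?P = "{\<pi>. \<pi> permutes {0..<m}}"
  have eq: "signof \<pi> * ((\<Prod>i\<in>F. A $$ (i, \<pi> i)) * (\<Prod>i\<in>{0..<m} - F. y * of_bool (\<pi> i = i)))
    = y ^ (m - card F) * (signof \<pi> * (\<Prod>i = 0..<m. principal_mat F A $$ (i, \<pi> i)))"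
    if \<pi>: "\<pi> permutes {0..<m}" and F: "F \<subseteq> {0..<m}" for \<pi> F
  proof -
    have fF: "finite F" using F finite_subset by auto
    have \<pi>lt: "\<pi> i < m" if "i < m" for i
      using \<pi> that by (metis atLeastLessThan_iff permutes_in_image zero_le)
    have c: "card ({0..<m} - F) = m - card F" using F by (simp add: card_Diff_subset fF)
    have split: "(\<Prod>i = 0..<m. principal_mat F A $$ (i, \<pi> i))
      = (\<Prod>i\<in>{0..<m} - F. principal_mat F A $$ (i, \<pi> i)) * (\<Prod>i\<in>F. principal_mat F A $$ (i, \<pi> i))"
      by (rule prod.subset_diff) (use F in auto)
    have out: "(\<Prod>i\<in>{0..<m} - F. principal_mat F A $$ (i, \<pi> i)) = (\<Prod>i\<in>{0..<m} - F. of_bool (\<pi> i = i))"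
      using A \<pi>lt by (intro prod.cong) (auto simp: principal_mat_def)
    show ?thesis
    proof (cases "\<forall>i\<in>{0..<m} - F. \<pi> i = i")
      case True
      have "\<pi> i \<in> F" if "i \<in> F" for i
      proof (rule ccontr)
        assume "\<pi> i \<notin> F"
        moreover have "\<pi> i < m" using that F \<pi>lt by auto
        ultimately have "\<pi> (\<pi> i) = \<pi> i" using True by auto
        then have "\<pi> i = i" using permutes_inj[OF \<pi>] by (metis injD)
        then show False using \<open>\<pi> i \<notin> F\<close> that by simp
      qed
      then have "(\<Prod>i\<in>F. principal_mat F A $$ (i, \<pi> i)) = (\<Prod>i\<in>F. A $$ (i, \<pi> i))"
        using A F \<pi>lt by (intro prod.cong) (auto simp: principal_mat_def subset_iff)
      moreover have "(\<Prod>i\<in>{0..<m} - F. y * of_bool (\<pi> i = i)) = y ^ (m - card F)"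
        using True c by simp
      moreover have "(\<Prod>i\<in>{0..<m} - F. of_bool (\<pi> i = i) :: 'a) = 1"
        using True by (intro prod.neutral) auto
      ultimately show ?thesis unfolding split out by (simp add: algebra_simps)
    next
      case False
      then obtain i where i: "i \<in> {0..<m} - F" "\<pi> i \<noteq> i" by blast
      then have "(\<Prod>i\<in>{0..<m} - F. y * of_bool (\<pi> i = i)) = 0"
        by (intro prod_zero) (auto intro!: bexI[of _ i])
      moreover have "(\<Prod>i\<in>{0..<m} - F. of_bool (\<pi> i = i) :: 'a) = 0"
        using i by (intro prod_zero) (auto intro!: bexI[of _ i])
      ultimately show ?thesis unfolding split out by simp
    qed
  qed
  have "Determinant.det (A + y \<cdot>\<^sub>m 1\<^sub>m m)
    = (\<Sum>\<pi>\<in>?P. signof \<pi> * (\<Prod>i = 0..<m. A $$ (i, \<pi> i) + y * of_bool (\<pi> i = i)))"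
  proof -
    have "(\<Prod>i = 0..<m. (A + y \<cdot>\<^sub>m 1\<^sub>m m) $$ (i, \<pi> i))
      = (\<Prod>i = 0..<m. A $$ (i, \<pi> i) + y * of_bool (\<pi> i = i))" if "\<pi> permutes {0..<m}" for \<pi>
    proof (rule prod.cong[OF refl])
      fix i assume "i \<in> {0..<m}"
      moreover then have "\<pi> i < m" using that by (metis atLeastLessThan_iff permutes_in_image)
      ultimately show "(A + y \<cdot>\<^sub>m 1\<^sub>m m) $$ (i, \<pi> i) = A $$ (i, \<pi> i) + y * of_bool (\<pi> i = i)"
        using A by auto
    qed
    then show ?thesis using A by (subst det_def'[of _ m]) auto
  qed
  also have "\<dots> = (\<Sum>\<pi>\<in>?P. \<Sum>F\<in>Pow {0..<m}. y ^ (m - card F) *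
      (signof \<pi> * (\<Prod>i = 0..<m. principal_mat F A $$ (i, \<pi> i))))"
    using eq by (intro sum.cong refl) (simp add: prod_add sum_distrib_left)
  also have "\<dots> = (\<Sum>F\<in>Pow {0..<m}. y ^ (m - card F) *
      (\<Sum>\<pi>\<in>?P. signof \<pi> * (\<Prod>i = 0..<m. principal_mat F A $$ (i, \<pi> i))))"
    by (subst sum.swap) (simp add: sum_distrib_left)
  also have "\<dots> = (\<Sum>F\<in>Pow {0..<m}. y ^ (m - card F) * Determinant.det (principal_mat F A))"
    using A by (intro sum.cong refl) (subst det_def'[of _ m], auto)
  finally show ?thesis .
qed

text \<open>Transposition negates exactly the entries that come from \<open>A\<close>, hence
  multiplies each Leibniz term by \<open>(-1) ^ card F\<close> while preserving the
  determinant.\<close>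

lemma even_card_if_det_skew_principal:
  fixes A :: "int mat"
  assumes A: "A \<in> carrier_mat m m" and skew: "\<And>i j. i < m \<Longrightarrow> j < m \<Longrightarrow> A $$ (j, i) = - A $$ (i, j)"
    and F: "F \<subseteq> {0..<m}" and det: "Determinant.det (principal_mat F A) \<noteq> 0"
  shows "even (card F)"
proof (rule ccontr)
  assume odd: "odd (card F)"
  let ?B = "principal_mat F A"
  have B: "?B \<in> carrier_mat m m" using A by simp
  have "Determinant.det (transpose_mat ?B) = (-1) ^ card F * Determinant.det ?B"
  proof -
    have "(\<Prod>i = 0..<m. transpose_mat ?B $$ (i, \<pi> i)) = (-1) ^ card F * (\<Prod>i = 0..<m. ?B $$ (i, \<pi> i))"
      if \<pi>: "\<pi> permutes {0..<m}" for \<pi>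
    proof -
      have \<pi>lt: "\<pi> i < m" if "i < m" for i
        using \<pi> that by (metis atLeastLessThan_iff permutes_in_image zero_le)
      have "(\<Prod>i = 0..<m. transpose_mat ?B $$ (i, \<pi> i)) = (\<Prod>i = 0..<m. (if i \<in> F then -1 else 1) * ?B $$ (i, \<pi> i))"
      proof (rule prod.cong[OF refl])
        fix i assume "i \<in> {0..<m}"
        then have "i < m" "\<pi> i < m" using \<pi>lt by auto
        then show "transpose_mat ?B $$ (i, \<pi> i) = (if i \<in> F then -1 else 1) * ?B $$ (i, \<pi> i)"
          using A skew[of i "\<pi> i"] by (auto simp: principal_mat_def)
      qed
      also have "\<dots> = (\<Prod>i = 0..<m. if i \<in> F then -1 else 1) * (\<Prod>i = 0..<m. ?B $$ (i, \<pi> i))"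
        by (rule prod.distrib)
      also have "(\<Prod>i = 0..<m. if i \<in> F then -1 else 1 :: int) = (-1) ^ card F"
      proof -
        have "{0..<m} \<inter> F = F" using F by blast
        then show ?thesis by (simp add: prod.If_cases)
      qed
      finally show ?thesis .
    qed
    then show ?thesis
      unfolding det_def'[OF B] det_def'[OF transpose_carrier_mat[THEN iffD2, OF B]]
      by (simp add: sum_distrib_left algebra_simps)
  qed
  then show False using det det_transpose[OF B] odd by simp
qed

lemma sum_difference_of_bool_mult:
  fixes g :: "nat \<Rightarrow> int"
  assumes "a < N" "b < N"
  shows "(\<Sum>k = 0..<N. (of_bool (k = a) - of_bool (k = b)) * g k) = g a - g b"
proof -
  have "(\<Sum>k = 0..<N. (of_bool (k = a) - of_bool (k = b)) * g k)
    = (\<Sum>k = 0..<N. if k = a then g k else 0) - (\<Sum>k = 0..<N. if k = b then g k else 0)"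
    unfolding sum_subtractf[symmetric] by (rule sum.cong) auto
  then show ?thesis using assms by simp
qed

lemma index_mult_mat_sum:
  assumes "A \<in> carrier_mat n k" "B \<in> carrier_mat k l" "i < n" "j < l"
  shows "(A * B) $$ (i, j) = (\<Sum>r = 0..<k. A $$ (i, r) * B $$ (r, j))"
  using assms by (simp add: scalar_prod_def)

text \<open>With \<open>V\<close> the matrix of columns \<open>e\<^sub>p - e\<^sub>q\<close> for the chords in \<open>F\<close>, the involution \<open>\<alpha>\<close> has the matrix
  \<open>1 - V V\<^sup>T\<close>. For the shift \<open>S\<close> and the strictly lower triangular matrix \<open>T = (1 - S)\<^sup>-\<^sup>1 S\<close> of ones,
  the chord matrix is \<open>1 + V\<^sup>T T V\<close>, and its determinant equals
  \<open>det (1 + T V V\<^sup>T) = det (1 - S (1 - V V\<^sup>T))\<close>.\<close>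

lemma det_principal_chord_mat:
  fixes p q :: "nat \<Rightarrow> nat" and A :: "int mat"
  assumes p: "inj_on p {0..<m}" and q: "inj_on q {0..<m}" and pq: "p ` {0..<m} \<inter> q ` {0..<m} = {}"
    and un: "p ` {0..<m} \<union> q ` {0..<m} = {0..<N}"
    and \<alpha>: "\<And>i. i < m \<Longrightarrow> \<alpha> (p i) = (if i \<in> F then q i else p i)"
      "\<And>i. i < m \<Longrightarrow> \<alpha> (q i) = (if i \<in> F then p i else q i)"
    and A: "A \<in> carrier_mat m m"
    and Adef: "\<And>i j. i < m \<Longrightarrow> j < m \<Longrightarrow> A $$ (i, j) = of_bool (i = j) +
       (of_bool (p j < p i) - of_bool (q j < p i) - (of_bool (p j < q i) - of_bool (q j < q i)))"
  shows "Determinant.det (principal_mat F A) = of_bool (transitive_on ((\<lambda>k. Suc k mod N) \<circ> \<alpha>) {0..<N})"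
proof -
  \<comment> \<open>Columns outside of \<open>F\<close> are zero, so that
    \<open>1 + V\<^sup>T T V\<close> is the identity there, just like
    \<open>principal_mat\<close>.\<close>
  define V where "V = mat N m (\<lambda>(k, i). if i \<in> F then of_bool (k = p i) - of_bool (k = q i) else 0 :: int)"
  define T where "T = mat N N (\<lambda>(i, j). of_bool (j < i) :: int)"
  define S where "S = mat N N (\<lambda>(i, j). of_bool (i = Suc j) :: int)"
  let ?V' = "transpose_mat V"
  have V: "V \<in> carrier_mat N m" and T: "T \<in> carrier_mat N N" and S: "S \<in> carrier_mat N N"
    and V': "?V' \<in> carrier_mat m N"
    by (auto simp: V_def T_def S_def)
  have TVc: "T * V \<in> carrier_mat N m" and VVc: "V * ?V' \<in> carrier_mat N N"
    using T V V' by auto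
  have IS: "1\<^sub>m N - S \<in> carrier_mat N N" using S by (rule minus_carrier_mat)
  have Ve: "V $$ (k, i) = (if i \<in> F then of_bool (k = p i) - of_bool (k = q i) else 0)"
    "?V' $$ (i, k) = V $$ (k, i)" if "k < N" "i < m" for k i
    using that by (auto simp: V_def)
  have Te: "T $$ (i, j) = of_bool (j < i)" and Se: "S $$ (i, j) = of_bool (i = Suc j)"
    if "i < N" "j < N" for i j using that by (auto simp: T_def S_def)
  have pN: "p i < N" "q i < N" if "i < m" for i
    using un that by (metis UnI1 UnI2 atLeastLessThan_iff image_eqI zero_le)+
  have cases: "\<exists>i<m. k = p i \<or> k = q i" if "k < N" for k
  proof -
    have "k \<in> p ` {0..<m} \<union> q ` {0..<m}" using un that by simp
    then show ?thesis by auto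
  qed
  have pinj: "p i = p j \<longleftrightarrow> i = j" "q i = q j \<longleftrightarrow> i = j" "p i \<noteq> q j" "q j \<noteq> p i" if "i < m" "j < m" for i j
  proof -
    have "p i \<in> p ` {0..<m}" "q j \<in> q ` {0..<m}" using that by auto
    then show "p i \<noteq> q j" "q j \<noteq> p i" using pq by (metis disjoint_iff)+
  qed (use p q that in \<open>auto simp: inj_on_eq_iff\<close>)
  have \<alpha>\<alpha>: "\<alpha> k < N \<and> \<alpha> (\<alpha> k) = k" if "k < N" for k
    using cases[OF that] \<alpha> pN by auto
  have TV: "(T * V) $$ (k, j) = (if j \<in> F then of_bool (p j < k) - of_bool (q j < k) else 0)"
    if "k < N" "j < m" for k j
  proof (cases "j \<in> F")
    case True
    have "(T * V) $$ (k, j) = (\<Sum>l = 0..<N. T $$ (k, l) * V $$ (l, j))"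
      by (rule index_mult_mat_sum[OF T V that])
    also have "\<dots> = (\<Sum>l = 0..<N. (of_bool (l = p j) - of_bool (l = q j)) * of_bool (l < k))"
      by (rule sum.cong) (use True that Te Ve in \<open>auto simp: mult.commute\<close>)
    also have "\<dots> = of_bool (p j < k) - of_bool (q j < k)"
      by (rule sum_difference_of_bool_mult[OF pN[OF that(2)]])
    finally show ?thesis using True by simp
  next
    case False
    have "(T * V) $$ (k, j) = (\<Sum>l = 0..<N. T $$ (k, l) * V $$ (l, j))"
      by (rule index_mult_mat_sum[OF T V that])
    also have "\<dots> = (\<Sum>l = 0..<N. 0)"
      by (rule sum.cong) (use False that Ve in auto)
    finally show ?thesis using False by simp
  qed
  have 1: "1\<^sub>m m + ?V' * (T * V) = principal_mat F A"
  proof (rule eq_matI)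
    fix i j assume "i < dim_row (principal_mat F A)" "j < dim_col (principal_mat F A)"
    then have ij: "i < m" "j < m" using A by (auto simp: principal_mat_def)
    have "(?V' * (T * V)) $$ (i, j) = (\<Sum>k = 0..<N. ?V' $$ (i, k) * (T * V) $$ (k, j))"
      by (rule index_mult_mat_sum[OF V' TVc ij])
    also have "\<dots> = (\<Sum>k = 0..<N. (of_bool (k = p i) - of_bool (k = q i)) *
        (of_bool (i \<in> F) * (T * V) $$ (k, j)))"
      by (rule sum.cong) (use ij Ve in auto)
    also have "\<dots> = of_bool (i \<in> F) * (T * V) $$ (p i, j) - of_bool (i \<in> F) * (T * V) $$ (q i, j)"
      by (rule sum_difference_of_bool_mult[OF pN[OF ij(1)]])
    also have "\<dots> = (if i \<in> F \<and> j \<in> F then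
         of_bool (p j < p i) - of_bool (q j < p i) - (of_bool (p j < q i) - of_bool (q j < q i)) else 0)"
      unfolding TV[OF pN(1)[OF ij(1)] ij(2)] TV[OF pN(2)[OF ij(1)] ij(2)] by auto
    finally have e: "(?V' * (T * V)) $$ (i, j) = \<dots>" .
    have "(1\<^sub>m m + ?V' * (T * V)) $$ (i, j) = of_bool (i = j) + (?V' * (T * V)) $$ (i, j)"
      using ij V V' by (subst index_add_mat) auto
    then show "(1\<^sub>m m + ?V' * (T * V)) $$ (i, j) = principal_mat F A $$ (i, j)"
      unfolding e using ij A Adef[OF ij] by (simp add: principal_mat_def)
  qed (use A V in \<open>auto simp: principal_mat_def\<close>)
  have ST: "(1\<^sub>m N - S) * T = S"
  proof (rule eq_matI)
    fix i j assume "i < dim_row S" "j < dim_col S"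
    then have ij: "i < N" "j < N" by (auto simp: S_def)
    have "((1\<^sub>m N - S) * T) $$ (i, j) = (\<Sum>k = 0..<N. (1\<^sub>m N - S) $$ (i, k) * T $$ (k, j))"
      by (rule index_mult_mat_sum[OF IS T ij])
    also have "\<dots> = (\<Sum>k = 0..<N. (of_bool (k = i) - of_bool (k = i - 1)) * of_bool (0 < i \<and> j < k))"
    proof (rule sum.cong[OF refl])
      fix k assume "k \<in> {0..<N}"
      then have "k < N" by simp
      then show "(1\<^sub>m N - S) $$ (i, k) * T $$ (k, j) =
          (of_bool (k = i) - of_bool (k = i - 1)) * of_bool (0 < i \<and> j < k)"
        using ij by (cases i) (auto simp: S_def T_def)
    qed
    also have "\<dots> = of_bool (0 < i \<and> j < i) - of_bool (0 < i \<and> j < i - 1)"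
      by (rule sum_difference_of_bool_mult) (use ij in auto)
    also have "\<dots> = of_bool (i = Suc j)" by auto
    finally show "((1\<^sub>m N - S) * T) $$ (i, j) = S $$ (i, j)" using ij by (simp add: S_def)
  qed (auto simp: S_def T_def)
  have VV: "(V * ?V') $$ (k, l) = of_bool (k = l) - of_bool (l = \<alpha> k)"
    if kl: "k < N" "l < N" for k l
  proof -
    \<comment> \<open>Each of the \<open>N\<close> positions is an end of exactly one chord, so a
      single term of the product survives.\<close>
    obtain i0 where i0: "i0 < m" "k = p i0 \<or> k = q i0" using cases[OF kl(1)] by blast
    have "(V * ?V') $$ (k, l) = (\<Sum>i = 0..<m. V $$ (k, i) * ?V' $$ (i, l))"
      by (rule index_mult_mat_sum[OF V V' kl])
    also have "\<dots> = (\<Sum>i = 0..<m. if i = i0 then V $$ (k, i0) * V $$ (l, i0) else 0)"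
    proof (rule sum.cong[OF refl])
      fix i assume "i \<in> {0..<m}"
      then have i: "i < m" by simp
      have "V $$ (k, i) = 0" if "i \<noteq> i0"
        using i0 pinj[OF i0(1) i] pinj[OF i i0(1)] that Ve(1)[OF kl(1) i] by auto
      then show "V $$ (k, i) * ?V' $$ (i, l) = (if i = i0 then V $$ (k, i0) * V $$ (l, i0) else 0)"
        using Ve(2)[OF kl(2) i] by auto
    qed
    also have "\<dots> = V $$ (k, i0) * V $$ (l, i0)" using i0 by simp
    also have "\<dots> = of_bool (k = l) - of_bool (l = \<alpha> k)"
      unfolding Ve(1)[OF kl(1) i0(1)] Ve(1)[OF kl(2) i0(1)]
      using i0 \<alpha>[OF i0(1)] pinj[of i0 i0] by auto
    finally show ?thesis .
  qed
  \<comment> \<open>The cyclic predecessor. Row 0 of \<open>S\<close> is zero, which is the cut;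
    wrapping 0 around to \<open>N - 1\<close> makes \<open>pr\<close> inverse to
    \<open>Suc k mod N\<close>.\<close>
  define pr where "pr k = (if k = 0 then N - 1 else k - 1)" for k
  have sc: "Suc k mod N = (if Suc k = N then 0 else Suc k)" if "k < N" for k
    using that by auto
  have pr: "pr k < N" "Suc (pr k) mod N = k" "pr (Suc k mod N) = k" "Suc k mod N < N" if "k < N" for k
    using that by (auto simp: pr_def sc)
  let ?Q = "mat N N (\<lambda>(i, j). of_bool (i = j) - of_bool (0 < i \<and> j = (\<alpha> \<circ> pr) i) :: int)"
  have 2: "1\<^sub>m N - S + S * (V * ?V') = ?Q"
  proof (rule eq_matI)
    fix i j assume "i < dim_row ?Q" "j < dim_col ?Q"
    then have ij: "i < N" "j < N" by auto
    have "(S * (V * ?V')) $$ (i, j) = (\<Sum>k = 0..<N. S $$ (i, k) * (V * ?V') $$ (k, j))"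
      by (rule index_mult_mat_sum[OF S VVc ij])
    also have "\<dots> = (\<Sum>k = 0..<N. if k = pr i then of_bool (0 < i) * (of_bool (pr i = j) - of_bool (j = \<alpha> (pr i))) else 0)"
    proof (rule sum.cong[OF refl])
      fix k assume "k \<in> {0..<N}"
      then have k: "k < N" by simp
      show "S $$ (i, k) * (V * ?V') $$ (k, j)
        = (if k = pr i then of_bool (0 < i) * (of_bool (pr i = j) - of_bool (j = \<alpha> (pr i))) else 0)"
        unfolding VV[OF k ij(2)] Se[OF ij(1) k] using ij k by (cases i) (auto simp: pr_def)
    qed
    also have "\<dots> = of_bool (0 < i) * (of_bool (pr i = j) - of_bool (j = \<alpha> (pr i)))"
      using pr(1)[OF ij(1)] by simp
    finally have e: "(S * (V * ?V')) $$ (i, j) = \<dots>" .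
    have "(1\<^sub>m N - S + S * (V * ?V')) $$ (i, j) = (1\<^sub>m N - S) $$ (i, j) + (S * (V * ?V')) $$ (i, j)"
      using ij S V by (subst index_add_mat) auto
    then show "(1\<^sub>m N - S + S * (V * ?V')) $$ (i, j) = ?Q $$ (i, j)"
      unfolding e using ij by (cases i) (auto simp: S_def pr_def)
  qed (use S V in auto)
  have detS: "Determinant.det (1\<^sub>m N - S) = 1"
  proof -
    have "diag_mat (1\<^sub>m N - S) = map (\<lambda>_. 1) [0..<N]" by (auto simp: diag_mat_def S_def)
    then show ?thesis
      by (subst det_lower_triangular[of N]) (auto simp: S_def map_replicate_const)
  qed
  have M: "1\<^sub>m N + T * V * ?V' \<in> carrier_mat N N" using T V by auto
  have "Determinant.det (principal_mat F A) = Determinant.det (1\<^sub>m N + T * V * ?V')"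
    unfolding 1[symmetric] by (rule det_one_plus_mult_commute[OF TVc V', symmetric])
  also have "\<dots> = Determinant.det ((1\<^sub>m N - S) * (1\<^sub>m N + T * V * ?V'))"
    unfolding det_mult[OF IS M] detS by simp
  also have "(1\<^sub>m N - S) * (1\<^sub>m N + T * V * ?V') = (1\<^sub>m N - S) * 1\<^sub>m N + (1\<^sub>m N - S) * (T * V * ?V')"
    by (rule mult_add_distrib_mat[OF IS one_carrier_mat]) (use T V in auto)
  also have "T * V * ?V' = T * (V * ?V')" by (rule assoc_mult_mat[OF T V V'])
  also have "(1\<^sub>m N - S) * (T * (V * ?V')) = S * (V * ?V')"
    unfolding assoc_mult_mat[OF IS T VVc, symmetric] ST ..
  also have "(1\<^sub>m N - S) * 1\<^sub>m N = 1\<^sub>m N - S" by (rule right_mult_one_mat[OF IS])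
  also note 2
  finally have det: "Determinant.det (principal_mat F A) = Determinant.det ?Q" .
  have \<alpha>b: "bij_betw \<alpha> {0..<N} {0..<N}"
    using \<alpha>\<alpha> by (intro bij_betw_byWitness[where f' = \<alpha>]) auto
  have sb: "bij_betw (\<lambda>k. Suc k mod N) {0..<N} {0..<N}"
    using pr by (intro bij_betw_byWitness[where f' = pr]) auto
  have prb: "bij_betw pr {0..<N} {0..<N}"
    using pr by (intro bij_betw_byWitness[where f' = "\<lambda>k. Suc k mod N"]) auto
  \<comment> \<open>Since \<alpha> is an involution, \<open>\<alpha> \<circ> pr\<close> is the
    inverse of the cyclic shift composed with \<alpha>.\<close>
  have "transitive_on (\<alpha> \<circ> pr) {0..<N} \<longleftrightarrow> transitive_on ((\<lambda>k. Suc k mod N) \<circ> \<alpha>) {0..<N}"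
    by (rule transitive_on_inverse[OF _ bij_betw_trans[OF \<alpha>b sb]]) (use \<alpha>\<alpha> pr in auto)
  then show ?thesis using det det_one_minus_cut_permutation[OF bij_betw_trans[OF prb \<alpha>b]] by simp
qed

section \<open>One-vertex dessins\<close>

text \<open>With \<open>f\<close> the position at which a chord is first met, this makes the
  definite description in \<open>chord\<close> meaningful: chords are numbered by rank.\<close>

lemma bij_betw_rank:
  fixes f :: "'a \<Rightarrow> nat"
  assumes fin: "finite E" and inj: "inj_on f E"
  shows "bij_betw (\<lambda>c. card {c' \<in> E. f c' < f c}) E {0..<card E}"
    and "\<And>c d. c \<in> E \<Longrightarrow> d \<in> E \<Longrightarrow> card {c' \<in> E. f c' < f c} < card {c' \<in> E. f c' < f d} \<longleftrightarrow> f c < f d"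
proof -
  let ?r = "\<lambda>c. card {c' \<in> E. f c' < f c}"
  have mono: "?r c < ?r d" if "c \<in> E" "f c < f d" for c d
    by (rule psubset_card_mono) (use that fin in auto)
  show *: "?r c < ?r d \<longleftrightarrow> f c < f d" if "c \<in> E" "d \<in> E" for c d
  proof (cases "f c" "f d" rule: linorder_cases)
    case equal
    then have "c = d" using inj that by (simp add: inj_on_eq_iff)
    then show ?thesis by simp
  qed (use mono[OF that(1), of d] mono[OF that(2), of c] in auto)
  have "inj_on ?r E"
  proof (rule inj_onI)
    fix c d assume cd: "c \<in> E" "d \<in> E" "?r c = ?r d"
    then have "f c = f d" using *[OF cd(1,2)] *[OF cd(2,1)] by simp
    then show "c = d" using inj cd by (simp add: inj_on_eq_iff)
  qed
  moreover have "?r ` E \<subseteq> {0..<card E}"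
  proof clarsimp
    fix c assume "c \<in> E"
    then show "?r c < card E" using fin by (intro psubset_card_mono) auto
  qed
  ultimately show "bij_betw ?r E {0..<card E}"
    by (simp add: bij_betw_def card_image card_subset_eq)
qed

section \<open>Faces of the spanning sub-dessins of a one-vertex dessin\<close>

locale one_vertex_dessin =
  fixes D :: "('v, 'd) dessin"
  assumes dessin: "dessin D" and one_vertex: "num_verts D = 1"
begin

text \<open>The involution \<alpha> of the overview. It acts on all darts, so that
  \<open>nxt D\<close> can be used unchanged for every \<open>F\<close>.\<close>

definition swap :: "'d set set \<Rightarrow> 'd \<Rightarrow> 'd" where
  "swap F d = (if d \<in> \<Union>F then opp D d else d)"

lemma finite_darts: "finite (darts D)" and nxt_permutes: "nxt D permutes darts D"
  and opp_permutes: "opp D permutes darts D"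
  using dessin by (auto simp: dessin_def)

lemma nxt_in: "d \<in> darts D \<Longrightarrow> nxt D d \<in> darts D"
  and opp_in: "d \<in> darts D \<Longrightarrow> opp D d \<in> darts D"
  by (simp_all add: permutes_in_image nxt_permutes opp_permutes)

lemma opp_opp: "d \<in> darts D \<Longrightarrow> opp D (opp D d) = d"
  and opp_neq: "d \<in> darts D \<Longrightarrow> opp D d \<noteq> d"
  using dessin by (auto simp: dessin_def)

lemma bij_nxt: "bij_betw (nxt D) (darts D) (darts D)"
  by (rule permutes_imp_bij[OF nxt_permutes])

lemma verts_eq: "\<exists>v. verts D = {v} \<and> (\<forall>d\<in>darts D. vtx D d = v)"
proof -
  obtain v where v: "verts D = {v}"
    using one_vertex by (auto simp: num_verts_def card_1_singleton_iff)
  moreover have "vtx D ` darts D \<subseteq> verts D" using dessin by (simp add: dessin_def)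
  ultimately show ?thesis by auto
qed

lemma transitive_nxt: "transitive_on (nxt D) (darts D)"
proof (rule transitive_onI)
  fix Z assume Z: "Z \<subseteq> darts D" "Z \<noteq> {}" "\<And>z. z \<in> Z \<Longrightarrow> nxt D z \<in> Z"
  then obtain z where z: "z \<in> Z" by blast
  have "y \<in> Z" if "y \<in> orbit (nxt D) z" for y
    using that by induct (use z Z in auto)
  moreover have "y \<in> orbit (nxt D) z" if "y \<in> darts D" for y
  proof -
    obtain v where "\<forall>d\<in>darts D. vtx D d = v" using verts_eq by blast
    then have "vtx D z = vtx D y" using that z Z(1) by (metis subsetD)
    then show ?thesis using that z Z(1) dessin by (auto simp: dessin_def)
  qed
  ultimately show "Z = darts D" using Z(1) by blast
qed

lemma edges_Union: "\<Union>(edges D) = darts D"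
  using opp_in by (auto simp: edges_def edge_def)

lemma edge_opp: "d \<in> darts D \<Longrightarrow> edge D (opp D d) = edge D d"
  by (auto simp: edge_def opp_opp)

lemma in_edgesE:
  assumes "c \<in> edges D" "d \<in> c"
  shows "d \<in> darts D" "c = edge D d"
proof -
  obtain e where e: "e \<in> darts D" "c = edge D e" using assms(1) by (auto simp: edges_def)
  then have "d = e \<or> d = opp D e" using assms(2) by (auto simp: edge_def)
  then show "d \<in> darts D" "c = edge D d" using e opp_in edge_opp by auto
qed

lemma mem_Union_iff:
  assumes "F \<subseteq> edges D" "d \<in> darts D"
  shows "d \<in> \<Union>F \<longleftrightarrow> edge D d \<in> F"
proof
  assume "d \<in> \<Union>F"
  then obtain c where "c \<in> F" "d \<in> c" by blast
  then show "edge D d \<in> F" using in_edgesE(2)[of c d] assms(1) by blast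
qed (auto simp: edge_def)

lemma finite_edges: "finite (edges D)"
  using finite_darts by (simp add: edges_def)

lemma swap_in: "F \<subseteq> edges D \<Longrightarrow> d \<in> darts D \<Longrightarrow> swap F d \<in> darts D"
  and swap_Union: "F \<subseteq> edges D \<Longrightarrow> d \<in> \<Union>F \<Longrightarrow> swap F d \<in> \<Union>F"
proof -
  show "swap F d \<in> darts D" if "F \<subseteq> edges D" "d \<in> darts D" using that opp_in by (auto simp: swap_def)
  show "swap F d \<in> \<Union>F" if F: "F \<subseteq> edges D" and d: "d \<in> \<Union>F"
  proof -
    have dd: "d \<in> darts D" using d F edges_Union by blast
    then have "edge D (opp D d) \<in> F" using d F edge_opp mem_Union_iff by simp
    then show ?thesis using d dd F mem_Union_iff[OF F opp_in[OF dd]] by (simp add: swap_def)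
  qed
qed

lemma swap_swap: "F \<subseteq> edges D \<Longrightarrow> d \<in> darts D \<Longrightarrow> swap F (swap F d) = d"
  using swap_Union[of F d] opp_opp by (auto simp: swap_def)

lemma bij_swap_Union:
  assumes F: "F \<subseteq> edges D"
  shows "bij_betw (swap F) (\<Union>F) (\<Union>F)"
proof -
  have "\<Union>F \<subseteq> darts D" using F edges_Union by blast
  then have 1: "\<forall>d\<in>\<Union>F. swap F (swap F d) = d" using swap_swap[OF F] by blast
  have 2: "swap F ` \<Union>F \<subseteq> \<Union>F" by (rule image_subsetI) (rule swap_Union[OF F])
  show ?thesis by (rule bij_betw_byWitness[OF 1 1 2 2])
qed

text \<open>The faces are the cycles of the inverse of \<nu> composed with \<open>swap F\<close>,
  where \<nu> is the induced cyclic order on the darts of \<open>F\<close>. Conjugation by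
  \<open>swap F\<close> followed by inversion yields \<open>\<nu> \<circ> swap F\<close>, and \<nu>
  is a first-return map of \<open>nxt D\<close>.\<close>

lemma num_faces_spanning_sub:
  assumes F: "F \<subseteq> edges D"
  shows "num_faces (spanning_sub D F) = 1 \<longleftrightarrow> transitive_on (nxt D \<circ> swap F) (darts D)"
proof (cases "F = {}")
  \<comment> \<open>Without edges the only face comes from the isolated vertex, while
    \<open>swap F\<close> is the identity and \<open>nxt D\<close> is transitive.\<close>
  case True
  obtain v where "verts D = {v}" using verts_eq by blast
  then have "num_faces (spanning_sub D F) = 1"
    using True by (simp add: num_faces_def spanning_sub_def isolated_verts_def)
  moreover have "nxt D \<circ> swap F = nxt D" using True by (simp add: swap_def fun_eq_iff)
  ultimately show ?thesis using transitive_nxt by simp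
next
  case False
  let ?H = "spanning_sub D F" and ?Y = "\<Union>F"
  have Y: "?Y \<subseteq> darts D" using F edges_Union by blast
  have finY: "finite ?Y" using Y finite_darts finite_subset by blast
  have Y0: "?Y \<noteq> {}"
  proof -
    obtain c where "c \<in> F" using False by blast
    moreover then obtain d where "d \<in> c" using F by (auto simp: edges_def edge_def)
    ultimately show ?thesis by blast
  qed
  obtain v where v: "verts D = {v}" "\<forall>d\<in>darts D. vtx D d = v" using verts_eq by blast
  have "v \<in> vtx D ` ?Y" using Y0 Y v(2) by (metis all_not_in_conv imageI subsetD)
  then have "isolated_verts ?H = {}"
    using v(1) by (simp add: isolated_verts_def spanning_sub_def)
  then have nf: "num_faces ?H = card (face ?H ` ?Y)"
    by (simp add: num_faces_def) (simp add: spanning_sub_def)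
  have fr: "bij_betw (first_return (nxt D) ?Y) ?Y ?Y"
    by (rule bij_betw_first_return[OF finite_darts permutes_inj[OF nxt_permutes] nxt_in transitive_nxt Y])
  define \<nu> where "\<nu> = nxt ?H"
  have \<nu>: "\<nu> d = (if d \<in> ?Y then first_return (nxt D) ?Y d else d)" for d
    by (simp add: \<nu>_def spanning_sub_def)
  have \<nu>Y: "bij_betw \<nu> ?Y ?Y" using fr by (subst bij_betw_cong[of _ _ "first_return (nxt D) ?Y"]) (auto simp: \<nu>)
  have "\<nu> permutes ?Y" by (rule bij_imp_permutes[OF \<nu>Y]) (auto simp: \<nu>)
  then have \<nu>inv: "Hilbert_Choice.inv \<nu> permutes ?Y" "Hilbert_Choice.inv \<nu> (\<nu> d) = d" for d
    using permutes_inv permutes_inverses by metis+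
  have opp: "opp ?H = swap F" by (simp add: spanning_sub_def swap_def fun_eq_iff)
  have "transitive_on (Hilbert_Choice.inv \<nu> \<circ> swap F) ?Y \<longleftrightarrow> transitive_on (swap F \<circ> Hilbert_Choice.inv \<nu>) ?Y"
    using \<nu>inv(1) by (intro transitive_on_conj_involution[OF bij_swap_Union[OF F]]) (simp only: permutes_in_image)
  also have "\<dots> \<longleftrightarrow> transitive_on (\<nu> \<circ> swap F) ?Y"
    by (rule transitive_on_inverse[OF finY bij_betw_trans[OF bij_swap_Union[OF F] \<nu>Y]])
       (use \<nu>inv swap_swap[OF F] Y in auto)
  also have "\<dots> \<longleftrightarrow> transitive_on (first_return (nxt D) ?Y \<circ> swap F) ?Y"
    using swap_Union[OF F] by (intro transitive_on_cong) (simp add: \<nu>)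
  also have "\<dots> \<longleftrightarrow> transitive_on (nxt D \<circ> swap F) (darts D)"
    by (rule transitive_on_first_return[OF finite_darts bij_nxt transitive_nxt Y Y0 bij_swap_Union[OF F], symmetric])
       (simp add: swap_def)
  finally have t: "transitive_on (Hilbert_Choice.inv \<nu> \<circ> swap F) ?Y \<longleftrightarrow> transitive_on (nxt D \<circ> swap F) (darts D)" .
  have "bij_betw (Hilbert_Choice.inv \<nu> \<circ> swap F) ?Y ?Y"
    by (rule bij_betw_trans[OF bij_swap_Union[OF F] permutes_imp_bij[OF \<nu>inv(1)]])
  from card_orbits_eq_1_iff[OF finY Y0 this] t
  show ?thesis unfolding nf by (simp add: face_def[abs_def] opp \<nu>_def[symmetric])
qed

text \<open>With a single vertex, connectedness is automatic and the edge count reads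
  \<open>card F = 2 * j\<close>; together with one face it yields genus \<open>j\<close>.\<close>

lemma quasi_tree_spanning_sub:
  assumes F: "F \<subseteq> edges D"
  shows "quasi_tree j (spanning_sub D F) \<longleftrightarrow>
    transitive_on (nxt D \<circ> swap F) (darts D) \<and> card F = 2 * j"
proof -
  let ?H = "spanning_sub D F"
  obtain v where v: "verts D = {v}" using verts_eq by blast
  have vH: "verts ?H = {v}" by (simp add: spanning_sub_def v)
  have "same_component ?H = {(v, v)}" by (auto simp: same_component_def vH)
  then have k: "num_components ?H = 1" by (simp add: num_components_def vH quotient_def)
  have "edges ?H = F"
  proof -
    have "edge ?H d = edge D d" if "d \<in> \<Union>F" for d
      using that by (auto simp: edge_def spanning_sub_def)
    then have "edges ?H = edge D ` \<Union>F" by (auto simp: edges_def spanning_sub_def)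
    also have "\<dots> = F"
    proof
      show "edge D ` \<Union>F \<subseteq> F" using in_edgesE(2) F by blast
      show "F \<subseteq> edge D ` \<Union>F"
      proof
        fix c assume c: "c \<in> F"
        then obtain d where "d \<in> c" using F by (auto simp: edges_def edge_def)
        then show "c \<in> edge D ` \<Union>F" using in_edgesE(2)[of c d] F c by blast
      qed
    qed
    finally show ?thesis .
  qed
  then have e: "num_edges ?H = card F" by (simp add: num_edges_def)
  have n: "num_verts ?H = 1" by (simp add: num_verts_def vH)
  have "genus ?H = of_nat j" if "num_faces ?H = 1" "card F = 2 * j"
    using that by (simp add: genus_def k e n)
  then show ?thesis
    unfolding num_faces_spanning_sub[OF F, symmetric]
    by (auto simp: quasi_tree_def connected_dessin_def k e n)
qed

lemma num_quasi_trees_eq: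
  "num_quasi_trees j D = card {F \<in> Pow (edges D). transitive_on (nxt D \<circ> swap F) (darts D) \<and> card F = 2 * j}"
proof -
  have "{F. F \<subseteq> edges D \<and> quasi_tree j (spanning_sub D F)}
    = {F \<in> Pow (edges D). transitive_on (nxt D \<circ> swap F) (darts D) \<and> card F = 2 * j}"
    using quasi_tree_spanning_sub by auto
  then show ?thesis by (simp add: num_quasi_trees_def)
qed

end

section \<open>Positions on the circle and the minors of the intersection matrix\<close>

locale chord_diagram = one_vertex_dessin D for D :: "('v, 'd) dessin" +
  fixes b :: 'd
  assumes base: "base_dart D b"
begin

definition label :: "nat \<Rightarrow> 'd" where
  "label k = (nxt D ^^ k) b"

lemma bij_label: "bij_betw label {0..<card (darts D)} (darts D)"
  and label_Suc: "k < card (darts D) \<Longrightarrow> label (Suc k mod card (darts D)) = nxt D (label k)"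
proof -
  have *: "bij_betw label {0..<card (darts D)} (darts D) \<and>
    (k < card (darts D) \<longrightarrow> label (Suc k mod card (darts D)) = nxt D (label k))" for k
  \<comment> \<open>Without darts the base dart is arbitrary, and both claims concern empty
    ranges.\<close>
  proof (cases "darts D = {}")
    case False
    then have b: "b \<in> darts D" using base by (simp add: base_dart_def)
    then have orb: "orbit (nxt D) b = darts D"
      by (intro transitive_on_orbit_eq[OF transitive_nxt nxt_in])
    then have "b \<in> orbit (nxt D) b" using b by simp
    note per = orbit_period[OF this, unfolded orb]
    have bij: "bij_betw label {0..<card (darts D)} (darts D)" using per(1) unfolding label_def .
    moreover have "label (Suc k mod card (darts D)) = nxt D (label k)" if "k < card (darts D)"
    proof (cases "Suc k = card (darts D)")
      case True
      then show ?thesis using per(2) unfolding True[symmetric] by (simp add: label_def)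
    qed (use that in \<open>simp add: label_def\<close>)
    ultimately show ?thesis using bij by auto
  qed (auto simp: bij_betw_def)
  show "bij_betw label {0..<card (darts D)} (darts D)" using * by blast
  show "k < card (darts D) \<Longrightarrow> label (Suc k mod card (darts D)) = nxt D (label k)" using * by blast
qed

lemma position_label: "k < card (darts D) \<Longrightarrow> position D b (label k) = k"
  unfolding position_def
proof (rule Least_equality)
  fix j assume k: "k < card (darts D)" and j: "(nxt D ^^ j) b = label k"
  show "k \<le> j"
  proof (rule ccontr)
    assume "\<not> k \<le> j"
    then have "label j = label k" "j < card (darts D)" "j \<noteq> k" using j k by (auto simp: label_def)
    then show False using bij_label k by (auto simp: bij_betw_def dest: inj_onD)
  qed
qed (simp add: label_def)

lemma label_position: "d \<in> darts D \<Longrightarrow> label (position D b d) = d \<and> position D b d < card (darts D)"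
proof -
  assume "d \<in> darts D"
  then have "d \<in> label ` {0..<card (darts D)}" using bij_label by (simp add: bij_betw_def)
  then obtain k where "k < card (darts D)" "d = label k" by auto
  then show ?thesis using position_label by simp
qed

lemma met_edge:
  assumes "c \<in> edges D"
  shows "first_met D b c < last_met D b c" "last_met D b c < card (darts D)"
    "c = {label (first_met D b c), label (last_met D b c)}"
    "opp D (label (first_met D b c)) = label (last_met D b c)"
    "opp D (label (last_met D b c)) = label (first_met D b c)"
proof -
  obtain d where d: "d \<in> darts D" "c = {d, opp D d}" using assms by (auto simp: edges_def edge_def)
  let ?x = "position D b d" and ?y = "position D b (opp D d)"
  have "?x \<noteq> ?y" using label_position[OF d(1)] label_position[OF opp_in[OF d(1)]] opp_neq[OF d(1)] by metis
  moreover have "first_met D b c = min ?x ?y" "last_met D b c = max ?x ?y"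
    by (simp_all add: first_met_def last_met_def d(2))
  ultimately have *: "first_met D b c = ?x \<and> last_met D b c = ?y \<and> ?x < ?y \<or>
      first_met D b c = ?y \<and> last_met D b c = ?x \<and> ?y < ?x" by auto
  have l: "label ?x = d" "label ?y = opp D d" "?x < card (darts D)" "?y < card (darts D)"
    using label_position[OF d(1)] label_position[OF opp_in[OF d(1)]] by auto
  show "first_met D b c < last_met D b c" "last_met D b c < card (darts D)"
    "c = {label (first_met D b c), label (last_met D b c)}"
    "opp D (label (first_met D b c)) = label (last_met D b c)"
    "opp D (label (last_met D b c)) = label (first_met D b c)"
    using * l d(2) opp_opp[OF d(1)] by auto
qed

lemma chord_of_label:
  assumes "c \<in> edges D" "c' \<in> edges D" "label k \<in> c" "label k \<in> c'"
  shows "c = c'"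
  using in_edgesE(2)[OF assms(1,3)] in_edgesE(2)[OF assms(2,4)] by simp

lemma bij_chord: "bij_betw (chord D b) {0..<num_edges D} (edges D)"
  and chord_less: "i < num_edges D \<Longrightarrow> j < num_edges D \<Longrightarrow>
    first_met D b (chord D b i) < first_met D b (chord D b j) \<longleftrightarrow> i < j"
proof -
  let ?r = "\<lambda>c. card {c' \<in> edges D. first_met D b c' < first_met D b c}"
  have inj: "inj_on (first_met D b) (edges D)"
  proof (rule inj_onI)
    fix c c' assume c: "c \<in> edges D" "c' \<in> edges D" "first_met D b c = first_met D b c'"
    then show "c = c'" using met_edge(3)[OF c(1)] met_edge(3)[OF c(2)]
      by (intro chord_of_label[of c c' "first_met D b c"]) auto
  qed
  note r = bij_betw_rank[OF finite_edges inj, folded num_edges_def]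
  have ch: "chord D b i \<in> edges D \<and> ?r (chord D b i) = i" if "i < num_edges D" for i
    unfolding chord_def
  proof (rule theI')
    have "i \<in> ?r ` edges D" using r(1) that by (simp add: bij_betw_def)
    then obtain c where c: "c \<in> edges D" "?r c = i" by blast
    show "\<exists>!c. c \<in> edges D \<and> ?r c = i"
    proof (rule ex1I[of _ c])
      show "c \<in> edges D \<and> ?r c = i" using c by simp
      show "c' = c" if "c' \<in> edges D \<and> ?r c' = i" for c'
        using inj_onD[OF bij_betw_imp_inj_on[OF r(1)], of c' c] that c by simp
    qed
  qed
  have chr: "chord D b (?r c) = c" if "c \<in> edges D" for c
  proof -
    have "?r c < num_edges D" using r(1) that by (auto simp: bij_betw_def)
    then show ?thesis
      using ch[of "?r c"] that inj_onD[OF bij_betw_imp_inj_on[OF r(1)], of "chord D b (?r c)" c] by blast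
  qed
  show "bij_betw (chord D b) {0..<num_edges D} (edges D)"
    by (rule bij_betw_byWitness[where f' = ?r]) (use ch chr r(1) in \<open>auto simp: bij_betw_def\<close>)
  show "first_met D b (chord D b i) < first_met D b (chord D b j) \<longleftrightarrow> i < j"
    if "i < num_edges D" "j < num_edges D"
    using ch[OF that(1)] ch[OF that(2)] r(2)[of "chord D b i" "chord D b j"] by simp
qed

lemma IM_carrier: "IM D b \<in> carrier_mat (num_edges D) (num_edges D)"
  by (simp add: IM_def)

lemma chord_ends_distinct:
  assumes "i < num_edges D" "j < num_edges D" "i \<noteq> j"
  shows "{first_met D b (chord D b i), last_met D b (chord D b i)} \<inter>
    {first_met D b (chord D b j), last_met D b (chord D b j)} = {}"
proof -
  have c: "chord D b i \<in> edges D" "chord D b j \<in> edges D" "chord D b i \<noteq> chord D b j"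
    using bij_chord assms by (auto simp: bij_betw_def dest: inj_onD)
  show ?thesis
  proof (rule ccontr)
    assume "\<not> ?thesis"
    then obtain k where k: "k \<in> {first_met D b (chord D b i), last_met D b (chord D b i)}"
      "k \<in> {first_met D b (chord D b j), last_met D b (chord D b j)}" by blast
    have "label k \<in> chord D b i" by (subst met_edge(3)[OF c(1)]) (use k(1) in blast)
    moreover have "label k \<in> chord D b j" by (subst met_edge(3)[OF c(2)]) (use k(2) in blast)
    ultimately show False using chord_of_label[OF c(1,2)] c(3) by blast
  qed
qed

lemma IM_skew: "i < num_edges D \<Longrightarrow> j < num_edges D \<Longrightarrow> IM D b $$ (j, i) = - IM D b $$ (i, j)"
  by (auto simp: IM_def chords_intersect_def sgn_if)

text \<open>This brings \<open>IM\<close> into the form \<open>1 + V\<^sup>T T V\<close>. On the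
  diagonal the four comparisons add up to -1, which the summand \<open>of_bool (i = j)\<close>
  cancels. Off the diagonal, \<open>i < j\<close> means that chord \<open>i\<close> starts first, so
  the comparisons reproduce the sign.\<close>

lemma IM_entry:
  assumes ij: "i < num_edges D" "j < num_edges D"
  defines "p \<equiv> \<lambda>i. first_met D b (chord D b i)" and "q \<equiv> \<lambda>i. last_met D b (chord D b i)"
  shows "IM D b $$ (i, j) = of_bool (i = j) +
       (of_bool (p j < p i) - of_bool (q j < p i) - (of_bool (p j < q i) - of_bool (q j < q i)))"
proof -
  have "chord D b i \<in> edges D" "chord D b j \<in> edges D"
    using bij_chord ij by (auto simp: bij_betw_def)
  then have lt: "p i < q i" "p j < q j" unfolding p_def q_def by (auto intro: met_edge)
  have *: "IM D b $$ (i, j) = (if p i < p j \<and> p j < q i \<and> q i < q j \<or> p j < p i \<and> p i < q j \<and> q j < q i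
      then sgn (int i - int j) else 0)"
    using ij by (simp add: IM_def chords_intersect_def p_def q_def)
  show ?thesis
  proof (cases "i = j")
    case True
    then show ?thesis using * lt by simp
  next
    case False
    have "p i \<noteq> p j" "p i \<noteq> q j" "q i \<noteq> p j" "q i \<noteq> q j"
      using chord_ends_distinct[OF ij False] by (auto simp: p_def q_def)
    moreover have "i < j \<longleftrightarrow> p i < p j" "j < i \<longleftrightarrow> p j < p i"
      using chord_less ij by (auto simp: p_def)
    ultimately show ?thesis
      using lt False unfolding * by (cases "i < j") (auto simp: sgn_if)
  qed
qed

text \<open>Reading darts as positions turns \<open>nxt D\<close> into the cyclic shift modulo the
  number of darts and \<open>swap\<close> into the involution \<alpha> on positions, so the
  determinant formula for chord matrices applies.\<close>

lemma det_principal_IM: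
  assumes G: "G \<subseteq> {0..<num_edges D}"
  shows "Determinant.det (principal_mat G (IM D b))
    = of_bool (transitive_on (nxt D \<circ> swap (chord D b ` G)) (darts D))"
proof -
  let ?m = "num_edges D" and ?N = "card (darts D)"
  define p where "p i = first_met D b (chord D b i)" for i
  define q where "q i = last_met D b (chord D b i)" for i
  define F where "F = chord D b ` G"
  define \<alpha> where "\<alpha> k = position D b (swap F (label k))" for k
  have ce: "chord D b i \<in> edges D" if "i < ?m" for i using bij_chord that by (auto simp: bij_betw_def)
  have F: "F \<subseteq> edges D" using G ce by (auto simp: F_def)
  have chF: "chord D b i \<in> F \<longleftrightarrow> i \<in> G" if "i < ?m" for i
    using bij_chord G that unfolding F_def bij_betw_def by (meson atLeastLessThan_iff inj_on_image_mem_iff zero_le)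
  note met = met_edge[OF ce, folded p_def q_def]
  have lF: "label (p i) \<in> \<Union>F \<longleftrightarrow> i \<in> G" "label (q i) \<in> \<Union>F \<longleftrightarrow> i \<in> G" if "i < ?m" for i
  proof -
    have "label (p i) \<in> chord D b i" "label (q i) \<in> chord D b i" using met(3)[OF that] by auto
    from in_edgesE[OF ce[OF that] this(1)] in_edgesE[OF ce[OF that] this(2)]
    show "label (p i) \<in> \<Union>F \<longleftrightarrow> i \<in> G" "label (q i) \<in> \<Union>F \<longleftrightarrow> i \<in> G"
      using mem_Union_iff[OF F] chF[OF that] by metis+
  qed
  have p: "inj_on p {0..<?m}"
    using chord_ends_distinct unfolding p_def by (intro inj_onI) fastforce
  have q: "inj_on q {0..<?m}"
    using chord_ends_distinct unfolding q_def by (intro inj_onI) fastforce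
  have pq: "p ` {0..<?m} \<inter> q ` {0..<?m} = {}"
  proof -
    have "p i \<noteq> q j" if "i < ?m" "j < ?m" for i j
      using chord_ends_distinct[OF that] met(1)[OF that(1)] by (cases "i = j") (auto simp: p_def q_def)
    then show ?thesis by auto
  qed
  have un: "p ` {0..<?m} \<union> q ` {0..<?m} = {0..<?N}"
  proof
    show "p ` {0..<?m} \<union> q ` {0..<?m} \<subseteq> {0..<?N}" using met(1,2) by fastforce
    show "{0..<?N} \<subseteq> p ` {0..<?m} \<union> q ` {0..<?m}"
    proof
      fix k assume "k \<in> {0..<?N}"
      then have k: "k < ?N" by simp
      then have "label k \<in> darts D" using bij_label by (auto simp: bij_betw_def)
      then have "edge D (label k) \<in> edges D" by (simp add: edges_def)
      then have "edge D (label k) \<in> chord D b ` {0..<?m}" using bij_chord by (simp add: bij_betw_def)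
      then obtain i where i: "i < ?m" "chord D b i = edge D (label k)" by auto
      then have "label k \<in> {label (p i), label (q i)}" using met(3)[OF i(1)] by (auto simp: edge_def)
      moreover have "p i < ?N" "q i < ?N" using met(1,2)[OF i(1)] by auto
      ultimately have "k = p i \<or> k = q i" using k bij_label by (auto simp: bij_betw_def dest: inj_onD)
      then show "k \<in> p ` {0..<?m} \<union> q ` {0..<?m}" using i by auto
    qed
  qed
  have a: "\<alpha> (p i) = (if i \<in> G then q i else p i)" "\<alpha> (q i) = (if i \<in> G then p i else q i)" if "i < ?m" for i
  proof -
    have "p i < ?N" "q i < ?N" using met(1,2)[OF that] by auto
    then show "\<alpha> (p i) = (if i \<in> G then q i else p i)" "\<alpha> (q i) = (if i \<in> G then p i else q i)"
      using lF[OF that] met(4,5)[OF that] by (auto simp: \<alpha>_def swap_def position_label)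
  qed
  have "Determinant.det (principal_mat G (IM D b)) = of_bool (transitive_on ((\<lambda>k. Suc k mod ?N) \<circ> \<alpha>) {0..<?N})"
    by (rule det_principal_chord_mat[OF p q pq un a IM_carrier]) (use IM_entry p_def q_def in auto)
  also have "transitive_on ((\<lambda>k. Suc k mod ?N) \<circ> \<alpha>) {0..<?N} \<longleftrightarrow> transitive_on (nxt D \<circ> swap F) (darts D)"
  proof (rule transitive_on_bij[OF bij_label])
    fix k assume "k \<in> {0..<?N}"
    then have k: "k < ?N" "label k \<in> darts D" using bij_label by (auto simp: bij_betw_def)
    have \<alpha>: "label (\<alpha> k) = swap F (label k)" "\<alpha> k < ?N"
      using label_position[OF swap_in[OF F k(2)]] by (auto simp: \<alpha>_def)
    show "(nxt D \<circ> swap F) (label k) = label (((\<lambda>k. Suc k mod ?N) \<circ> \<alpha>) k)"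
      using label_Suc[OF \<alpha>(2)] \<alpha>(1) by simp
    show "((\<lambda>k. Suc k mod ?N) \<circ> \<alpha>) k \<in> {0..<?N}" using k by auto
  qed
  finally show ?thesis by (simp add: F_def)
qed

text \<open>Stated over an arbitrary commutative ring, because \<open>y\<close> is the polynomial
  \<open>- [:0, 1:]\<close> for the characteristic polynomial and \<open>- \<i>\<close> for the link
  determinant.\<close>

lemma det_IM_add_scaled_one:
  fixes y :: "'c :: comm_ring_1"
  shows "Determinant.det (map_mat of_int (IM D b) + y \<cdot>\<^sub>m 1\<^sub>m (num_edges D))
    = (\<Sum>F\<in>Pow (edges D). y ^ (num_edges D - card F) * of_bool (transitive_on (nxt D \<circ> swap F) (darts D)))"
proof -
  let ?m = "num_edges D" and ?A = "map_mat of_int (IM D b) :: 'c mat"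
  have A: "?A \<in> carrier_mat ?m ?m" using IM_carrier by simp
  have "principal_mat G ?A = map_mat of_int (principal_mat G (IM D b))" for G
    by (rule eq_matI) (auto simp: principal_mat_def)
  then have P: "Determinant.det (principal_mat G ?A) = of_int (Determinant.det (principal_mat G (IM D b)))" for G
    by (simp add: of_int_hom.hom_det)
  have card: "card (chord D b ` G) = card G" if "G \<subseteq> {0..<?m}" for G
    using bij_chord that by (metis bij_betw_def card_image inj_on_subset)
  have "Determinant.det (?A + y \<cdot>\<^sub>m 1\<^sub>m ?m) = (\<Sum>G\<in>Pow {0..<?m}. y ^ (?m - card G) * Determinant.det (principal_mat G ?A))"
    by (rule det_add_scaled_one[OF A])
  also have "\<dots> = (\<Sum>G\<in>Pow {0..<?m}. y ^ (?m - card (chord D b ` G)) *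
      of_bool (transitive_on (nxt D \<circ> swap (chord D b ` G)) (darts D)))"
    by (rule sum.cong[OF refl]) (simp add: P det_principal_IM card)
  also have "\<dots> = (\<Sum>F\<in>Pow (edges D). y ^ (?m - card F) * of_bool (transitive_on (nxt D \<circ> swap F) (darts D)))"
    by (rule sum.reindex_bij_betw[OF bij_betw_Pow[OF bij_chord]])
  finally show ?thesis .
qed

text \<open>This is the integrality of the genus, obtained algebraically: the minor of such an
  \<open>F\<close> is 1, whereas skew-symmetric minors of odd order vanish.\<close>

lemma even_card_if_transitive:
  assumes "F \<subseteq> edges D" "transitive_on (nxt D \<circ> swap F) (darts D)"
  shows "even (card F)"
proof -
  obtain G where G: "G \<subseteq> {0..<num_edges D}" "F = chord D b ` G"
    using assms(1) bij_chord by (metis bij_betw_imp_surj_on subset_imageE)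
  then have "card F = card G" using bij_chord by (metis bij_betw_def card_image inj_on_subset)
  moreover have "even (card G)"
    by (rule even_card_if_det_skew_principal[OF IM_carrier IM_skew G(1)])
       (use assms G det_principal_IM[OF G(1)] in auto)
  ultimately show ?thesis by simp
qed

lemma sum_by_genus:
  fixes y :: "'c :: comm_ring_1"
  shows "(\<Sum>F\<in>Pow (edges D). y ^ (num_edges D - card F) * of_bool (transitive_on (nxt D \<circ> swap F) (darts D)))
    = (\<Sum>j = 0..num_edges D div 2. of_nat (num_quasi_trees j D) * y ^ (num_edges D - 2 * j))"
proof -
  let ?m = "num_edges D" and ?t = "\<lambda>F. transitive_on (nxt D \<circ> swap F) (darts D)"
  let ?Q = "{F \<in> Pow (edges D). ?t F}"
  have fin: "finite (Pow (edges D))" using finite_edges by simp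
  have le: "card F \<le> ?m" if "F \<subseteq> edges D" for F
    using card_mono[OF finite_edges that] by (simp add: num_edges_def)
  have "(\<Sum>F\<in>Pow (edges D). y ^ (?m - card F) * of_bool (?t F)) = (\<Sum>F\<in>?Q. y ^ (?m - card F))"
    using fin by (intro sum.mono_neutral_cong_right) auto
  \<comment> \<open>Grouping by \<open>card F div 2\<close> covers all \<open>F\<close>; by the
    parity result the group of \<open>j\<close> consists of the \<open>F\<close> with exactly
    \<open>2 * j\<close> chords.\<close>
  also have "\<dots> = (\<Sum>j = 0..?m div 2. \<Sum>F\<in>{F \<in> ?Q. card F div 2 = j}. y ^ (?m - card F))"
    using fin le by (intro sum.group[symmetric]) (auto intro!: div_le_mono)
  also have "\<dots> = (\<Sum>j = 0..?m div 2. of_nat (num_quasi_trees j D) * y ^ (?m - 2 * j))"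
  proof (rule sum.cong[OF refl])
    fix j
    have "{F \<in> ?Q. card F div 2 = j} = {F \<in> Pow (edges D). ?t F \<and> card F = 2 * j}"
      using even_card_if_transitive by auto
    then show "(\<Sum>F\<in>{F \<in> ?Q. card F div 2 = j}. y ^ (?m - card F)) = of_nat (num_quasi_trees j D) * y ^ (?m - 2 * j)"
      by (simp add: num_quasi_trees_eq)
  qed
  finally show ?thesis .
qed

text \<open>All exponents \<open>m - 2 * j\<close> have the parity of \<open>m\<close>, so the signs
  of the powers of \<open>- [:0, 1:]\<close> combine into one global factor.\<close>

lemma char_poly_IM:
  "Determinant.det (map_mat (\<lambda>a. [:a:]) (IM D b) - [:0, 1:] \<cdot>\<^sub>m 1\<^sub>m (num_edges D))
    = (-1) ^ num_edges D * (\<Sum>j = 0..num_edges D div 2. monom (int (num_quasi_trees j D)) (num_edges D - 2 * j))"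
proof -
  let ?m = "num_edges D"
  have "map_mat (\<lambda>a. [:a:]) (IM D b) - [:0, 1:] \<cdot>\<^sub>m 1\<^sub>m ?m = map_mat of_int (IM D b) + (- [:0, 1:]) \<cdot>\<^sub>m 1\<^sub>m ?m"
    by (rule eq_matI) (use IM_carrier in \<open>auto simp: of_int_poly\<close>)
  then have "Determinant.det (map_mat (\<lambda>a. [:a:]) (IM D b) - [:0, 1:] \<cdot>\<^sub>m 1\<^sub>m ?m)
    = (\<Sum>j = 0..?m div 2. of_nat (num_quasi_trees j D) * (- [:0, 1:]) ^ (?m - 2 * j))"
    by (simp only: det_IM_add_scaled_one sum_by_genus)
  also have "\<dots> = (\<Sum>j = 0..?m div 2. (-1) ^ ?m * monom (int (num_quasi_trees j D)) (?m - 2 * j))"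
  proof (rule sum.cong[OF refl])
    fix j assume "j \<in> {0..?m div 2}"
    then have j: "2 * j \<le> ?m" by auto
    have "(- [:0, 1:] :: int poly) ^ (?m - 2 * j) = (-1) ^ (?m - 2 * j) * monom 1 (?m - 2 * j)"
      by (subst power_minus) (simp add: monom_altdef)
    also have "(-1 :: int poly) ^ (?m - 2 * j) = (-1) ^ ?m"
      using j by (simp add: minus_one_power_iff)
    finally show "of_nat (num_quasi_trees j D) * (- [:0, 1:]) ^ (?m - 2 * j)
      = (-1) ^ ?m * monom (int (num_quasi_trees j D)) (?m - 2 * j)"
      by (simp add: of_nat_poly smult_monom mult.left_commute)
  qed
  finally show ?thesis by (simp add: sum_distrib_left)
qed

end

section \<open>Link diagrams with a single all-A circle\<close>

text \<open>The spanning tree bound for a connected graph with vertex set \<open>R\<close> and edges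
  indexed by \<open>K\<close>, with loops and parallel edges allowed. A set \<open>T\<close> grows
  from \<open>r0\<close> by one vertex at a time, and each new vertex brings a new edge inside
  \<open>T\<close>.\<close>

lemma card_reachable_le:
  fixes a b :: "'k \<Rightarrow> 'r"
  assumes K: "finite K" and R: "finite R" "r0 \<in> R"
    and ab: "\<And>k. k \<in> K \<Longrightarrow> a k \<in> R \<and> b k \<in> R"
    and reach: "\<And>r. r \<in> R \<Longrightarrow> (r0, r) \<in> ((\<lambda>k. (a k, b k)) ` K \<union> (\<lambda>k. (b k, a k)) ` K)\<^sup>*"
  shows "card R \<le> card K + 1"
proof -
  let ?E = "(\<lambda>k. (a k, b k)) ` K \<union> (\<lambda>k. (b k, a k)) ` K"
  let ?K = "\<lambda>T. {k \<in> K. a k \<in> T \<and> b k \<in> T}"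
  have "\<exists>T\<subseteq>R. r0 \<in> T \<and> card T = Suc t \<and> card T \<le> card (?K T) + 1" if "t < card R" for t
    using that
  proof (induct t)
    case 0
    then show ?case using R by (intro exI[of _ "{r0}"]) auto
  next
    case (Suc t)
    have "t < card R" using Suc.prems by simp
    from Suc.hyps[OF this] obtain T where
      T: "T \<subseteq> R" "r0 \<in> T" "card T = Suc t" "card T \<le> card (?K T) + 1" by blast
    then have "T \<noteq> R" using Suc.prems by auto
    then obtain r where r: "r \<in> R" "r \<notin> T" using T by blast
    \<comment> \<open>If no edge left \<open>T\<close>, everything reachable from \<open>r0\<close>
      would lie in \<open>T\<close>.\<close>
    have "\<exists>x y. (x, y) \<in> ?E \<and> x \<in> T \<and> y \<notin> T"
    proof (rule ccontr)
      assume no: "\<not> ?thesis"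
      from reach[OF r(1)] have "r \<in> T"
      proof (induct rule: rtrancl_induct)
        case base
        show ?case by (rule T(2))
      next
        case (step y z)
        then show ?case using no by blast
      qed
      then show False using r by simp
    qed
    then obtain x y k where k: "k \<in> K" "x \<in> T" "y \<notin> T" "a k = x \<and> b k = y \<or> a k = y \<and> b k = x" by auto
    have fin: "finite T" using T(1) R(1) finite_subset by blast
    have finK: "finite (?K T')" for T' using K by simp
    have "y \<in> R" using ab[OF k(1)] k(4) by blast
    moreover have "insert k (?K T) \<subseteq> ?K (insert y T)" using k by auto
    then have "card (insert k (?K T)) \<le> card (?K (insert y T))" by (rule card_mono[OF finK])
    moreover have "k \<notin> ?K T" using k by auto
    then have "card (insert k (?K T)) = card (?K T) + 1" using finK by simp
    ultimately show ?case using T fin k(3) by (intro exI[of _ "insert y T"]) auto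
  qed
  note grow = this[of "card R - 1"]
  obtain T where T: "T \<subseteq> R" "card T = card R" "card T \<le> card (?K T) + 1"
  proof -
    have "0 < card R" using R by (auto simp: card_gt_0_iff)
    then have "card R - 1 < card R" "Suc (card R - 1) = card R" by auto
    then show ?thesis using grow that by auto
  qed
  have "card (?K T) \<le> card K" using K by (intro card_mono) auto
  then show ?thesis using T by simp
qed

section \<open>Link diagrams: crossings, splicings and the number of regions\<close>

locale diagram =
  fixes P :: "('v, 'd) link_diagram"
  assumes diagram: "connected_link_diagram P"
begin

abbreviation "X \<equiv> darts (projection P)"
abbreviation "nx \<equiv> nxt (projection P)"
abbreviation "op \<equiv> opp (projection P)"
abbreviation "vx \<equiv> vtx (projection P)"
abbreviation "fc \<equiv> face (projection P)"

lemma dessin: "dessin (projection P)"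
  using diagram by (simp add: connected_link_diagram_def)

lemma finite_darts: "finite X" and nx_permutes: "nx permutes X" and op_permutes: "op permutes X"
  and op_op: "d \<in> X \<Longrightarrow> op (op d) = d" and op_neq: "d \<in> X \<Longrightarrow> op d \<noteq> d"
  and finite_verts: "finite (verts (projection P))"
  and vx_in: "d \<in> X \<Longrightarrow> vx d \<in> verts (projection P)"
  and vx_eq_iff: "d \<in> X \<Longrightarrow> d' \<in> X \<Longrightarrow> vx d = vx d' \<longleftrightarrow> d' \<in> orbit nx d"
  using dessin by (auto simp: dessin_def)

lemma nx_in [simp]: "d \<in> X \<Longrightarrow> nx d \<in> X" and op_in [simp]: "d \<in> X \<Longrightarrow> op d \<in> X"
  and inv_nx_in [simp]: "d \<in> X \<Longrightarrow> Hilbert_Choice.inv nx d \<in> X"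
  by (simp_all add: permutes_in_image nx_permutes op_permutes permutes_inv)

lemma inv_nx_nx [simp]: "Hilbert_Choice.inv nx (nx d) = d" "nx (Hilbert_Choice.inv nx d) = d"
  using permutes_inverses[OF nx_permutes] by auto

lemma outer_in: "outer P \<in> X"
  using diagram by (simp add: connected_link_diagram_def)

lemma over_subset: "d \<in> over P \<Longrightarrow> d \<in> crossing_darts P"
  and over_nx: "d \<in> crossing_darts P \<Longrightarrow> nx d \<in> over P \<longleftrightarrow> d \<notin> over P"
  using diagram by (auto simp: connected_link_diagram_def)

lemma crossing_in [simp]: "d \<in> crossing_darts P \<Longrightarrow> d \<in> X"
  by (simp add: crossing_darts_def)

lemma finite_crossings: "finite (crossings P)"
  using finite_verts by (simp add: crossings_def)

lemma orbit_nx: "d \<in> X \<Longrightarrow> orbit nx d = {d' \<in> X. vx d' = vx d}"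
proof -
  assume d: "d \<in> X"
  have "d' \<in> X" if "d' \<in> orbit nx d" for d'
    using that by induct (use d in auto)
  then show ?thesis using vx_eq_iff[OF d] by (auto simp: eq_commute[of "vx d"])
qed

lemma card_orbit_nx: "d \<in> X \<Longrightarrow> card (orbit nx d) = valence (projection P) (vx d)"
  by (simp add: orbit_nx valence_def)

lemma self_in_orbit_nx: "d \<in> X \<Longrightarrow> d \<in> orbit nx d"
  by (simp add: orbit_nx)

lemma vx_nx [simp]: "d \<in> X \<Longrightarrow> vx (nx d) = vx d"
  using orbit_nx orbit.base[of nx d] by auto

lemma vx_inv_nx [simp]: "d \<in> X \<Longrightarrow> vx (Hilbert_Choice.inv nx d) = vx d"
  using vx_nx[of "Hilbert_Choice.inv nx d"] by simp

lemma valence: "v \<in> verts (projection P) \<Longrightarrow> valence (projection P) v = (if v \<in> crossings P then 4 else 2)"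
  using diagram by (auto simp: connected_link_diagram_def crossings_def)

lemma nx4: "d \<in> crossing_darts P \<Longrightarrow> nx (nx (nx (nx d))) = d"
proof -
  assume d: "d \<in> crossing_darts P"
  then have "card (orbit nx d) = 4"
    by (simp add: card_orbit_nx crossing_darts_def crossings_def del: crossing_in)
  then have "(nx ^^ 4) d = d" using orbit_period(2)[OF self_in_orbit_nx[of d]] d by simp
  then show ?thesis by (simp add: eval_nat_numeral)
qed

lemma nx2: "d \<in> X \<Longrightarrow> d \<notin> crossing_darts P \<Longrightarrow> nx (nx d) = d"
proof -
  assume d: "d \<in> X" "d \<notin> crossing_darts P"
  then have "card (orbit nx d) = 2"
    using valence[OF vx_in[OF d(1)]] by (simp add: card_orbit_nx crossing_darts_def del: crossing_in)
  then have "(nx ^^ 2) d = d" using orbit_period(2)[OF self_in_orbit_nx[OF d(1)]] by simp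
  then show ?thesis by (simp add: eval_nat_numeral)
qed

lemma crossing_nx [simp]: "d \<in> X \<Longrightarrow> nx d \<in> crossing_darts P \<longleftrightarrow> d \<in> crossing_darts P"
  and crossing_inv_nx [simp]: "d \<in> X \<Longrightarrow> Hilbert_Choice.inv nx d \<in> crossing_darts P \<longleftrightarrow> d \<in> crossing_darts P"
  by (auto simp: crossing_darts_def simp del: crossing_in)

lemma over_inv_nx: "d \<in> crossing_darts P \<Longrightarrow> Hilbert_Choice.inv nx d \<in> over P \<longleftrightarrow> d \<notin> over P"
  using over_nx[of "Hilbert_Choice.inv nx d"] by simp

lemma inv_nx_crossing: "d \<in> crossing_darts P \<Longrightarrow> Hilbert_Choice.inv nx d = nx (nx (nx d))"
  using nx4 by (metis inv_nx_nx(1))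

lemma inv_nx_noncrossing: "d \<in> X \<Longrightarrow> d \<notin> crossing_darts P \<Longrightarrow> Hilbert_Choice.inv nx d = nx d"
  using nx2 by (metis inv_nx_nx(1))

lemma over_same_vertex:
  assumes "d \<in> over P" "d' \<in> over P" "vx d = vx d'"
  shows "d' = d \<or> d' = nx (nx d)"
proof -
  note c = over_subset[OF assms(1)] over_subset[OF assms(2)]
  have "card (orbit nx d) = 4" using c(1)
    by (simp add: card_orbit_nx crossing_darts_def crossings_def del: crossing_in)
  moreover have "d' \<in> orbit nx d" using assms(3) c by (simp add: orbit_nx)
  ultimately have "d' \<in> (\<lambda>k. (nx ^^ k) d) ` {0..<4}"
    using orbit_period(1)[OF self_in_orbit_nx[of d]] c(1) by (simp add: bij_betw_def)
  then have "d' = d \<or> d' = nx d \<or> d' = nx (nx d) \<or> d' = nx (nx (nx d))"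
    by (auto simp: eval_nat_numeral less_Suc_eq)
  moreover have "nx d \<notin> over P" "nx (nx (nx d)) \<notin> over P"
    using assms(1) c(1) by (auto simp: over_nx)
  ultimately show ?thesis using assms(2) by metis
qed

lemma crossing_over_dart: "v \<in> crossings P \<Longrightarrow> \<exists>d\<in>over P. vx d = v"
proof -
  assume v: "v \<in> crossings P"
  then have "card {d \<in> X. vx d = v} = 4" by (simp add: crossings_def valence_def)
  then have "{d \<in> X. vx d = v} \<noteq> {}" by (metis card.empty zero_neq_numeral)
  then obtain d where d: "d \<in> X" "vx d = v" by blast
  then have "d \<in> crossing_darts P" using v by (simp add: crossing_darts_def del: crossing_in)
  then have "d \<in> over P \<or> nx d \<in> over P" by (simp add: over_nx)
  then show ?thesis using d vx_nx[OF d(1)] by metis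
qed

lemma splice_in [simp]: "d \<in> X \<Longrightarrow> splice P S d \<in> X"
  and vx_splice [simp]: "d \<in> X \<Longrightarrow> vx (splice P S d) = vx d"
  and crossing_splice [simp]: "d \<in> X \<Longrightarrow> splice P S d \<in> crossing_darts P \<longleftrightarrow> d \<in> crossing_darts P"
  and over_splice: "d \<in> crossing_darts P \<Longrightarrow> splice P S d \<in> over P \<longleftrightarrow> d \<notin> over P"
  by (auto simp: splice_def over_nx over_inv_nx)

lemma splice_splice [simp]: "d \<in> X \<Longrightarrow> splice P S (splice P S d) = d"
  using nx2[of d] over_splice[of d S]
  by (cases "d \<in> crossing_darts P") (auto simp: splice_def over_nx over_inv_nx)

lemma card_darts_valence: "card X = (\<Sum>v\<in>verts (projection P). valence (projection P) v)"
proof -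
  have "X = (\<Union>v\<in>verts (projection P). {d \<in> X. vx d = v})" using vx_in by blast
  then have "card X = card (\<Union>v\<in>verts (projection P). {d \<in> X. vx d = v})" by simp
  also have "\<dots> = (\<Sum>v\<in>verts (projection P). card {d \<in> X. vx d = v})"
    using finite_verts finite_darts by (intro card_UN_disjoint) auto
  finally show ?thesis by (simp add: valence_def)
qed

lemma card_darts_edges: "card X = 2 * num_edges (projection P)"
proof -
  let ?E = "edges (projection P)"
  have "\<Union>?E = X" using op_in by (auto simp: edges_def edge_def)
  moreover have "card (\<Union>?E) = sum card ?E"
  proof (rule card_Union_disjoint)
    show "pairwise disjnt ?E"
      by (auto simp: pairwise_def disjnt_def edges_def edge_def op_op) (metis op_op)+
  qed (auto simp: edges_def edge_def)
  moreover have "card c = 2" if c: "c \<in> ?E" for c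
  proof -
    obtain d where "d \<in> X" "c = {d, op d}" using c by (auto simp: edges_def edge_def)
    then show ?thesis using op_neq[of d] by simp
  qed
  ultimately show ?thesis by (simp add: num_edges_def)
qed

text \<open>Counting darts by valence gives \<open>e = v + n\<close> for \<open>n\<close> crossings,
  as the other vertices have valence 2. Euler's formula in genus 0 then leaves \<open>n + 2\<close>
  faces.\<close>

lemma card_faces: "card (fc ` X) = card (crossings P) + 2"
proof -
  let ?V = "verts (projection P)"
  have c: "crossings P \<subseteq> ?V" by (auto simp: crossings_def)
  have "(\<Sum>v\<in>?V. valence (projection P) v) = (\<Sum>v\<in>?V. 2 + (if v \<in> crossings P then 2 else 0))"
    by (rule sum.cong) (simp_all add: valence)
  also have "\<dots> = 2 * card ?V + 2 * card (crossings P)"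
    using c finite_verts by (subst sum.distrib) (simp add: sum.If_cases Int_absorb1)
  finally have e: "num_edges (projection P) = card ?V + card (crossings P)"
    using card_darts_valence card_darts_edges by simp
  have "v \<in> vx ` X" if "v \<in> ?V" for v
  proof -
    have "card {d \<in> X. vx d = v} \<noteq> 0" using valence[OF that] by (auto simp: valence_def split: if_splits)
    then have "{d \<in> X. vx d = v} \<noteq> {}" by (metis card.empty)
    then show ?thesis by blast
  qed
  then have "isolated_verts (projection P) = {}" by (auto simp: isolated_verts_def)
  moreover have "genus (projection P) = 0" "num_components (projection P) = 1"
    using diagram by (auto simp: connected_link_diagram_def connected_dessin_def)
  ultimately have "of_nat (card (crossings P) + 2) = (of_nat (card (fc ` X)) :: rat)"
    using e by (simp add: genus_def num_faces_def num_verts_def)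
  then show ?thesis by (simp only: of_nat_eq_iff)
qed

lemma face_inv_nx_op: "d \<in> X \<Longrightarrow> fc (Hilbert_Choice.inv nx (op d)) = fc d"
proof -
  assume d: "d \<in> X"
  let ?f = "Hilbert_Choice.inv nx \<circ> op"
  have f: "?f permutes X" using permutes_compose[OF op_permutes permutes_inv[OF nx_permutes]] .
  then have "permutation ?f" using finite_darts by (auto simp: permutation_permutes)
  then have "d \<in> orbit ?f d" by (rule permutation_self_in_orbit)
  then have "orbit ?f (?f d) = orbit ?f d" by (rule self_in_orbit_step)
  then show ?thesis by (simp add: face_def)
qed

lemma state_circle_subset: "d \<in> X \<Longrightarrow> state_circle P S d \<subseteq> X"
proof
  fix d' assume d: "d \<in> X" and "d' \<in> state_circle P S d"
  then have "(d, d') \<in> ({(x, op x) | x. x \<in> X} \<union> {(x, splice P S x) | x. x \<in> X})\<^sup>*"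
    by (simp add: state_circle_def)
  then show "d' \<in> X" by (induct rule: rtrancl_induct) (use d in auto)
qed

lemma state_circle_closed:
  assumes "d \<in> Z" "\<And>x. x \<in> Z \<Longrightarrow> x \<in> X \<Longrightarrow> op x \<in> Z" "\<And>x. x \<in> Z \<Longrightarrow> x \<in> X \<Longrightarrow> splice P S x \<in> Z"
  shows "state_circle P S d \<subseteq> Z"
proof
  fix d' assume "d' \<in> state_circle P S d"
  then have "(d, d') \<in> ({(x, op x) | x. x \<in> X} \<union> {(x, splice P S x) | x. x \<in> X})\<^sup>*"
    by (simp add: state_circle_def)
  then show "d' \<in> Z" by (induct rule: rtrancl_induct) (use assms in auto)
qed

lemma state_circle_self: "d \<in> state_circle P S d"
  and state_circle_op: "x \<in> state_circle P S d \<Longrightarrow> x \<in> X \<Longrightarrow> op x \<in> state_circle P S d"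
  and state_circle_splice: "x \<in> state_circle P S d \<Longrightarrow> x \<in> X \<Longrightarrow> splice P S x \<in> state_circle P S d"
  by (auto simp: state_circle_def intro: rtrancl_into_rtrancl)

lemma single_state_circle:
  assumes "card (state_circles P S) = 1" "d \<in> X"
  shows "state_circle P S d = X"
proof
  obtain C where C: "state_circles P S = {C}" using assms(1) by (auto simp: card_1_singleton_iff)
  then have "state_circle P S x = C" if "x \<in> X" for x using that by (auto simp: state_circles_def)
  then show "X \<subseteq> state_circle P S d" using assms(2) state_circle_self by blast
qed (rule state_circle_subset[OF assms(2)])

end

section \<open>The two sides of a single all-A circle\<close>

locale single_circle_diagram = diagram P for P :: "('v, 'd) link_diagram" +
  assumes single: "card (state_circles P {}) = 1"
begin

text \<open>The value of \<open>region_adj\<close> for the circle \<open>X\<close>: no edge lies off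
  the circle, so only the corners opened by the A-splicings connect regions.\<close>

definition adj where "adj = {(fc x, fc (nx (nx x))) | x. x \<in> over P}"

text \<open>The classes are the components of the complement of the circle.\<close>

definition sim where "sim r r' \<longleftrightarrow> (r, r') \<in> adj\<^sup>*"

lemma state_circle_empty: "d \<in> X \<Longrightarrow> state_circle P {} d = X"
  by (rule single_state_circle[OF single])

lemma region_adj_eq: "region_adj P X = adj"
  by (simp add: region_adj_def adj_def)

lemma over_nx_nx: "x \<in> over P \<Longrightarrow> nx (nx x) \<in> over P"
  using over_subset[of x] over_nx[of x] over_nx[of "nx x"] by simp

lemma sim_refl: "sim r r" and sim_trans: "sim r r' \<Longrightarrow> sim r' r'' \<Longrightarrow> sim r r''"
  and sim_over: "x \<in> over P \<Longrightarrow> sim (fc x) (fc (nx (nx x)))"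
  by (auto simp: sim_def adj_def)

lemma sim_sym: "sim r r' \<Longrightarrow> sim r' r"
proof -
  have "sym adj"
  proof (rule symI)
    fix r r' assume "(r, r') \<in> adj"
    then obtain x where x: "x \<in> over P" "r = fc x" "r' = fc (nx (nx x))" by (auto simp: adj_def)
    moreover have "nx (nx (nx (nx x))) = x" using nx4 over_subset x by blast
    ultimately show "(r', r) \<in> adj" using over_nx_nx[of x] by (force simp: adj_def)
  qed
  then show "sim r r' \<Longrightarrow> sim r' r" unfolding sim_def by (meson sym_rtrancl symD)
qed

text \<open>A strand arriving along \<open>y\<close> has \<open>fc (op y)\<close> on its left, and
  leaves with \<open>fc (splice P {} y)\<close> on its left. Turning to the predecessor of
  \<open>y\<close> keeps the same region; otherwise the two regions meet through the opened
  corner.\<close>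

lemma sim_arrive: "y \<in> X \<Longrightarrow> sim (fc (splice P {} y)) (fc (op y))"
proof (cases "splice P {} y = Hilbert_Choice.inv nx y")
  case True
  assume "y \<in> X"
  then show ?thesis using True face_inv_nx_op[of "op y"] sim_refl by (simp add: op_op)
next
  case False
  assume y: "y \<in> X"
  have c: "y \<in> crossing_darts P" "y \<notin> over P"
    using False inv_nx_noncrossing[OF y] by (auto simp: splice_def split: if_splits)
  then have sp: "splice P {} y = nx y" "nx y \<in> over P" by (auto simp: splice_def over_nx)
  have "fc (op y) = fc (Hilbert_Choice.inv nx y)" using face_inv_nx_op[of "op y"] y by (simp add: op_op)
  then show ?thesis using sim_over[OF sp(2)] sp(1) inv_nx_crossing[OF c(1)] by simp
qed

text \<open>The pair of side classes is carried along the circle by \<open>op\<close> and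
  \<open>splice\<close>, up to order, and the circle runs through every dart. Hence there are at
  most two classes.\<close>

lemma two_sides:
  assumes x: "x \<in> X" and w: "w \<in> X"
  shows "sim (fc w) (fc x) \<and> sim (fc (op w)) (fc (op x)) \<or>
    sim (fc w) (fc (op x)) \<and> sim (fc (op w)) (fc x)"
proof -
  let ?Z = "{w \<in> X. sim (fc w) (fc x) \<and> sim (fc (op w)) (fc (op x)) \<or>
    sim (fc w) (fc (op x)) \<and> sim (fc (op w)) (fc x)}"
  have "state_circle P {} x \<subseteq> ?Z"
  proof (rule state_circle_closed)
    show "x \<in> ?Z" using x sim_refl by blast
    show "op y \<in> ?Z" if "y \<in> ?Z" "y \<in> X" for y using that by (auto simp: op_op)
    show "splice P {} y \<in> ?Z" if "y \<in> ?Z" "y \<in> X" for y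
    proof -
      have "sim (fc (splice P {} y)) (fc (op y))" by (rule sim_arrive[OF that(2)])
      moreover have "sim (fc (op (splice P {} y))) (fc y)"
        using sim_sym[OF sim_arrive[of "splice P {} y"]] that(2) by simp
      ultimately show ?thesis using that sim_trans by auto
    qed
  qed
  then show ?thesis using state_circle_empty[OF x] w by blast
qed

text \<open>The Jordan curve theorem for the single all-A circle: the opened corners provide only \<open>n\<close>
  adjacencies between the \<open>n + 2\<close> regions of a projection with \<open>n\<close> crossings.\<close>

lemma sides_separated:
  assumes x: "x \<in> X"
  shows "\<not> sim (fc x) (fc (op x))"
proof
  assume s: "sim (fc x) (fc (op x))"
  have all: "sim (fc x) (fc w)" if "w \<in> X" for w
    using two_sides[OF x that] sim_sym sim_trans s by metis
  \<comment> \<open>One over-dart per crossing suffices: the two over-darts yield the same pair of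
    regions in opposite order.\<close>
  define d where "d v = (SOME d. d \<in> over P \<and> vx d = v)" for v
  have d: "d v \<in> over P" "vx (d v) = v" if "v \<in> crossings P" for v
    using someI_ex[of "\<lambda>d. d \<in> over P \<and> vx d = v"] crossing_over_dart[OF that] unfolding d_def by blast+
  let ?a = "\<lambda>v. fc (d v)" and ?b = "\<lambda>v. fc (nx (nx (d v)))"
  have sub: "adj \<subseteq> (\<lambda>v. (?a v, ?b v)) ` crossings P \<union> (\<lambda>v. (?b v, ?a v)) ` crossings P"
  proof
    fix e assume "e \<in> adj"
    then obtain y where y: "y \<in> over P" "e = (fc y, fc (nx (nx y)))" by (auto simp: adj_def)
    let ?v = "vx y"
    have v: "?v \<in> crossings P" using over_subset[OF y(1)] by (simp add: crossing_darts_def del: crossing_in)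
    have "d ?v = y \<or> d ?v = nx (nx y)"
      by (rule over_same_vertex[OF y(1) d(1)[OF v]]) (simp add: d(2)[OF v])
    moreover have "nx (nx (nx (nx y))) = y" using nx4 over_subset y by blast
    ultimately have "e = (?a ?v, ?b ?v) \<or> e = (?b ?v, ?a ?v)" using y(2) by auto
    then show "e \<in> (\<lambda>v. (?a v, ?b v)) ` crossings P \<union> (\<lambda>v. (?b v, ?a v)) ` crossings P"
      using v by blast
  qed
  have "card (fc ` X) \<le> card (crossings P) + 1"
  proof (rule card_reachable_le[where a = ?a and b = ?b and ?r0.0 = "fc x"])
    show "?a v \<in> fc ` X \<and> ?b v \<in> fc ` X" if "v \<in> crossings P" for v
      using over_subset[OF d(1)[OF that]] by simp
    show "(fc x, r) \<in> ((\<lambda>v. (?a v, ?b v)) ` crossings P \<union> (\<lambda>v. (?b v, ?a v)) ` crossings P)\<^sup>*"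
      if "r \<in> fc ` X" for r
      using that all rtrancl_mono[OF sub] by (auto simp: sim_def)
  qed (use finite_crossings finite_darts x in auto)
  then show False using card_faces by simp
qed

lemma depth_eq: "x \<in> X \<Longrightarrow> depth P (state_circle P {} x) = 0"
proof -
  assume x: "x \<in> X"
  have "state_circles P {} = {X}" using state_circle_empty outer_in by (force simp: state_circles_def)
  then have "{C \<in> state_circles P {}. lies_inside P X C} = {}" by (auto simp: lies_inside_def)
  then show ?thesis unfolding depth_def state_circle_empty[OF x] by (simp only: card.empty)
qed

text \<open>Depth 0 means anti-clockwise orientation, so \<open>x\<close> is inward if
  \<open>fc (op x)\<close>, the left side on the way to the vertex, is not joined to the unbounded
  region.\<close>

lemma inward_iff_not_sim: "x \<in> X \<Longrightarrow> inward P x \<longleftrightarrow> \<not> sim (fc (outer P)) (fc (op x))"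
  unfolding inward_def depth_eq interior_regions_def
  by (simp add: state_circle_empty region_adj_eq sim_def)

text \<open>By \<open>two_sides\<close> and \<open>sides_separated\<close>, exactly one side of each
  edge belongs to the class of the unbounded region.\<close>

lemma inward_iff_sim: "x \<in> X \<Longrightarrow> inward P x \<longleftrightarrow> sim (fc (outer P)) (fc x)"
proof -
  assume x: "x \<in> X"
  have "sim (fc (outer P)) (fc x) \<or> sim (fc (outer P)) (fc (op x))"
    using two_sides[OF x outer_in] by blast
  moreover have "\<not> (sim (fc (outer P)) (fc x) \<and> sim (fc (outer P)) (fc (op x)))"
    using sides_separated[OF x] sim_sym sim_trans by blast
  ultimately show ?thesis using inward_iff_not_sim[OF x] by blast
qed

lemma inward_op: "x \<in> X \<Longrightarrow> inward P (op x) \<longleftrightarrow> \<not> inward P x"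
  by (simp add: inward_iff_not_sim[of x] inward_iff_sim[of "op x"])

lemma inward_splice_A: "x \<in> X \<Longrightarrow> inward P (splice P {} x) \<longleftrightarrow> \<not> inward P x"
  unfolding inward_iff_not_sim inward_iff_sim[OF splice_in]
  using sim_arrive sim_sym sim_trans by blast

text \<open>The coherence that lets one orientation serve all states: opposite darts point the same
  way, so the B-splicing also pairs an inward with an outward dart. For over-darts the two regions
  are joined through the opened corners; the under-darts follow as their A-splicing
  partners.\<close>

lemma inward_nx_nx: "x \<in> crossing_darts P \<Longrightarrow> inward P (nx (nx x)) \<longleftrightarrow> inward P x"
proof -
  have over: "inward P (nx (nx x)) \<longleftrightarrow> inward P x" if x: "x \<in> over P" for x
  proof -
    have X: "x \<in> X" "nx (nx x) \<in> X" using over_subset[OF x] by auto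
    show ?thesis unfolding inward_iff_sim[OF X(1)] inward_iff_sim[OF X(2)]
      using sim_over[OF x] sim_sym sim_trans by blast
  qed
  assume x: "x \<in> crossing_darts P"
  show ?thesis
  proof (cases "x \<in> over P")
    case False
    define y where "y = nx x"
    have y: "y \<in> over P" "y \<in> X" "x = Hilbert_Choice.inv nx y"
      using x False by (auto simp: y_def over_nx)
    have "splice P {} y = x" "splice P {} (nx (nx y)) = nx (nx x)"
      using y over_nx_nx[OF y(1)] over_subset[OF y(1)] over_subset[OF over_nx_nx[OF y(1)]]
      by (simp_all add: splice_def)
    then have "inward P x \<longleftrightarrow> \<not> inward P y" "inward P (nx (nx x)) \<longleftrightarrow> \<not> inward P (nx (nx y))"
      using inward_splice_A[of y] inward_splice_A[of "nx (nx y)"] y by auto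
    then show ?thesis using over[OF y(1)] by simp
  qed (rule over)
qed

text \<open>B-splicing at the crossings in \<open>S\<close> amounts to jumping to the opposite dart before A-splicing.\<close>

definition half_turn :: "'v set \<Rightarrow> 'd \<Rightarrow> 'd" where
  "half_turn S x = (if x \<in> crossing_darts P \<and> vx x \<in> S then nx (nx x) else x)"

lemma half_turn_in [simp]: "x \<in> X \<Longrightarrow> half_turn S x \<in> X"
  and crossing_half_turn [simp]: "x \<in> X \<Longrightarrow> half_turn S x \<in> crossing_darts P \<longleftrightarrow> x \<in> crossing_darts P"
  and inward_half_turn: "inward P (half_turn S x) \<longleftrightarrow> inward P x"
  and half_turn_half_turn: "half_turn S (half_turn S x) = x"
  by (auto simp: half_turn_def inward_nx_nx nx4)

text \<open>Opposite darts are both over or both under, so the A-splicing turns them in the same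
  sense; from the opposite dart this leads to the other neighbour of \<open>x\<close>.\<close>

lemma splice_half_turn: "x \<in> X \<Longrightarrow> splice P S x = splice P {} (half_turn S x)"
proof (cases "x \<in> crossing_darts P \<and> vx x \<in> S")
  case True
  assume x: "x \<in> X"
  have "nx (nx x) \<in> over P \<longleftrightarrow> x \<in> over P" using True by (simp add: over_nx)
  then show ?thesis using True x inv_nx_crossing[of x] by (auto simp: splice_def half_turn_def)
qed (auto simp: splice_def half_turn_def)

lemma inward_splice: "x \<in> X \<Longrightarrow> inward P (splice P S x) \<longleftrightarrow> \<not> inward P x"
  by (subst splice_half_turn) (simp_all add: inward_splice_A inward_half_turn)

text \<open>Each edge has exactly one inward dart. For every state,
  \<open>op \<circ> splice P S\<close> permutes these darts, so that unoriented circles become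
  cycles of a permutation.\<close>

definition In where "In = {x \<in> X. inward P x}"

lemma bij_step: "bij_betw (op \<circ> splice P S) In In"
proof (rule bij_betw_byWitness[where f' = "splice P S \<circ> op"])
  have InX: "x \<in> X" if "x \<in> In" for x using that by (simp add: In_def)
  show "\<forall>x\<in>In. (splice P S \<circ> op) ((op \<circ> splice P S) x) = x"
    by (metis InX comp_apply op_op splice_in splice_splice)
  show "\<forall>x\<in>In. (op \<circ> splice P S) ((splice P S \<circ> op) x) = x"
    by (metis InX comp_apply op_op op_in splice_splice)
  show "(op \<circ> splice P S) ` In \<subseteq> In" "(splice P S \<circ> op) ` In \<subseteq> In"
    using inward_op inward_splice by (auto simp: In_def)
qed

lemma finite_In: "finite In"
  using finite_darts by (simp add: In_def)

lemma single_state_circle_iff: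
  "card (state_circles P S) = 1 \<longleftrightarrow> transitive_on (op \<circ> splice P S) In"
proof
  assume s: "card (state_circles P S) = 1"
  show "transitive_on (op \<circ> splice P S) In"
  proof (rule transitive_onI)
    fix Z assume Z: "Z \<subseteq> In" "Z \<noteq> {}" "\<And>z. z \<in> Z \<Longrightarrow> (op \<circ> splice P S) z \<in> Z"
    then obtain z where z: "z \<in> Z" by blast
    have ZX: "Z \<subseteq> X" using Z(1) by (auto simp: In_def)
    have "(op \<circ> splice P S) ` Z = Z"
      by (rule invariant_image_eq[OF finite_In bij_betw_imp_inj_on[OF bij_step] Z(1)]) (use Z(3) in blast)
    \<comment> \<open>An invariant set of inward darts together with its splicing partners, which
      are outward, is closed under both moves of a state circle.\<close>
    have "state_circle P S z \<subseteq> Z \<union> splice P S ` Z"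
    proof (rule state_circle_closed)
      show "splice P S x \<in> Z \<union> splice P S ` Z" if "x \<in> Z \<union> splice P S ` Z" "x \<in> X" for x
        using that ZX by auto
      show "op x \<in> Z \<union> splice P S ` Z" if x: "x \<in> Z \<union> splice P S ` Z" "x \<in> X" for x
      proof (cases "x \<in> Z")
        case True
        then obtain z' where z': "z' \<in> Z" "x = op (splice P S z')"
          using \<open>(op \<circ> splice P S) ` Z = Z\<close> by auto
        then have "op x = splice P S z'" using ZX by (auto simp: op_op)
        then show ?thesis using z' by blast
      next
        case False
        then show ?thesis using x Z(3) by auto
      qed
    qed (use z in blast)
    moreover have "state_circle P S z = X" by (rule single_state_circle[OF s]) (use z ZX in blast)
    moreover have "splice P S x \<notin> In" if "x \<in> Z" for x
      using that Z(1) inward_splice by (auto simp: In_def)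
    ultimately show "Z = In" using Z(1) by (auto simp: In_def)
  qed
next
  assume t: "transitive_on (op \<circ> splice P S) In"
  have "state_circle P S d = X" if d: "d \<in> X" for d
  proof -
    let ?C = "state_circle P S d"
    have C: "?C \<subseteq> X" by (rule state_circle_subset[OF d])
    have "?C \<inter> In = In"
    proof (rule transitive_onD[OF t])
      have "d \<in> In \<or> op d \<in> In" using d by (auto simp: In_def inward_op)
      then show "?C \<inter> In \<noteq> {}" using state_circle_self[of d S] state_circle_op[of d S d] d by blast
      show "(op \<circ> splice P S) z \<in> ?C \<inter> In" if "z \<in> ?C \<inter> In" for z
        using that state_circle_splice[of z S d] state_circle_op[of "splice P S z" S d]
        by (auto simp: In_def inward_op inward_splice)
    qed auto
    moreover have "x \<in> ?C" if "x \<in> X" "op x \<in> ?C" for x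
      using state_circle_op[of "op x" S d] that by (simp add: op_op)
    moreover have "x \<in> In \<or> op x \<in> In" if "x \<in> X" for x
      using that inward_op[OF that] by (simp add: In_def)
    ultimately have "X \<subseteq> ?C" by blast
    then show ?thesis using C by blast
  qed
  then have "state_circles P S = {X}" using outer_in by (force simp: state_circles_def)
  then show "card (state_circles P S) = 1" by simp
qed

section \<open>The cyclic order of the arc-ends as a first-return map\<close>

definition Y where "Y = In \<inter> crossing_darts P"

definition \<tau> where "\<tau> = op \<circ> splice P {}"

lemma \<tau>_In: "y \<in> In \<Longrightarrow> \<tau> y \<in> In"
  using bij_step[of "{}"] by (auto simp: \<tau>_def bij_betw_def)

lemma transitive_\<tau>: "transitive_on \<tau> In"
  using single_state_circle_iff[of "{}"] single by (simp add: \<tau>_def)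

text \<open>\<open>next_arc_end\<close> waits for any dart at a crossing; since \<tau> preserves
  \<open>In\<close>, this is the same as waiting for an inward one.\<close>

lemma first_return_crossing: "y \<in> In \<Longrightarrow> first_return \<tau> (crossing_darts P) y = first_return \<tau> Y y"
proof -
  assume y: "y \<in> In"
  have "(\<tau> ^^ k) y \<in> In" for k by (induct k) (use y \<tau>_In in auto)
  then show ?thesis by (simp add: first_return_def Y_def)
qed

lemma first_return_Y: "y \<in> Y \<Longrightarrow> first_return \<tau> Y y \<in> Y"
proof -
  assume y: "y \<in> Y"
  then have "y \<in> In" by (simp add: Y_def)
  then obtain k where "0 < k" "(\<tau> ^^ k) y = y" using transitive_on_returns[OF transitive_\<tau> \<tau>_In] by blast
  then show ?thesis using first_return_ex[of k \<tau> y Y] y by auto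
qed

lemma bij_half_turn: "bij_betw (half_turn S) Y Y"
  by (rule bij_betw_byWitness[where f' = "half_turn S"])
     (auto simp: Y_def In_def half_turn_half_turn inward_half_turn)

lemma arrival_Y: "d \<in> over P \<Longrightarrow> arrival P d \<in> Y"
  using over_subset[of d] by (auto simp: arrival_def Y_def In_def inward_splice)

lemma arc_end_arrival: "d \<in> over P \<Longrightarrow> arc_end P (arrival P d) = d"
  using over_subset[of d] by (auto simp: arrival_def arc_end_def over_splice)

lemma arc_end_over: "y \<in> Y \<Longrightarrow> arc_end P y \<in> over P"
  by (auto simp: arc_end_def Y_def over_splice)

lemma arrival_arc_end: "y \<in> Y \<Longrightarrow> arrival P (arc_end P y) = y"
  by (auto simp: arrival_def arc_end_def Y_def In_def inward_splice)

text \<open>Every strand of an A-splicing at a crossing has exactly one over-dart and exactly one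
  inward dart; \<open>arrival\<close> and \<open>arc_end\<close> exchange the two.\<close>

lemma bij_arrival: "bij_betw (arrival P) (over P) Y"
  by (rule bij_betw_byWitness[where f' = "arc_end P"])
     (auto simp: arrival_Y arc_end_over arc_end_arrival arrival_arc_end)

lemma arrival_next_arc_end:
  assumes "d \<in> over P"
  shows "next_arc_end P d \<in> over P" "arrival P (next_arc_end P d) = first_return \<tau> Y (arrival P d)"
proof -
  have y: "arrival P d \<in> Y" "arrival P d \<in> In" using arrival_Y[OF assms] by (auto simp: Y_def)
  have "next_arc_end P d = arc_end P (first_return \<tau> Y (arrival P d))"
    unfolding next_arc_end_def using first_return_crossing[OF y(2)] by (simp add: \<tau>_def)
  then show "next_arc_end P d \<in> over P" "arrival P (next_arc_end P d) = first_return \<tau> Y (arrival P d)"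
    using arc_end_over arrival_arc_end first_return_Y[OF y(1)] by auto
qed

lemma half_turn_over: "d \<in> over P \<Longrightarrow> half_turn S d \<in> over P"
  by (auto simp: half_turn_def over_nx_nx)

lemma arrival_half_turn: "d \<in> over P \<Longrightarrow> arrival P (half_turn S d) = half_turn S (arrival P d)"
proof -
  assume d: "d \<in> over P"
  note c = over_subset[OF d]
  have "splice P {} (nx (nx d)) = nx (nx (splice P {} d))"
    using d c over_subset[OF over_nx_nx[OF d]] over_nx_nx[OF d] inv_nx_crossing[OF c] nx4[OF c] by (simp add: splice_def)
  then show ?thesis using c
    by (auto simp: arrival_def inward_half_turn inward_nx_nx half_turn_def)
qed

text \<open>On \<open>In\<close> the state \<open>S\<close> acts as
  \<open>\<tau> \<circ> half_turn S\<close>, and \<open>half_turn S\<close> moves only darts in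
  \<open>Y\<close>. Restriction to \<open>Y\<close> by first returns and conjugation by
  \<open>arrival\<close> yield the cyclic order of the all-A dessin.\<close>

lemma single_state_circle_iff_all_A:
  assumes "S \<subseteq> crossings P"
  shows "card (state_circles P S) = 1 \<longleftrightarrow> transitive_on (nxt (all_A_dessin P) \<circ> half_turn S) (over P)"
proof (cases "over P = {}")
  \<comment> \<open>Without crossings there are no arc-ends to return to; \<open>S\<close> is then
    the all-A state itself.\<close>
  case True
  then have "crossings P = {}" using crossing_over_dart by blast
  then have "S = {}" using assms by simp
  then show ?thesis using True single by (simp add: transitive_on_def)
next
  case False
  then have Y0: "Y \<noteq> {}" using arrival_Y by blast
  have "card (state_circles P S) = 1 \<longleftrightarrow> transitive_on (\<tau> \<circ> half_turn S) In"
    unfolding single_state_circle_iff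
    unfolding \<tau>_def
  proof (rule transitive_on_cong)
    fix x assume "x \<in> In"
    then have "x \<in> X" by (simp add: In_def)
    then show "(op \<circ> splice P S) x = (op \<circ> splice P {} \<circ> half_turn S) x"
      by (simp only: comp_apply splice_half_turn[of x S])
  qed
  also have "\<dots> \<longleftrightarrow> transitive_on (first_return \<tau> Y \<circ> half_turn S) Y"
    by (rule transitive_on_first_return[OF finite_In _ transitive_\<tau> _ Y0 bij_half_turn])
       (use bij_step in \<open>auto simp: \<tau>_def Y_def half_turn_def\<close>)
  also have "\<dots> \<longleftrightarrow> transitive_on (nxt (all_A_dessin P) \<circ> half_turn S) (over P)"
    by (rule transitive_on_bij[OF bij_arrival, symmetric])
       (simp_all add: all_A_dessin_def half_turn_over arrival_next_arc_end arrival_half_turn)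
  finally show ?thesis .
qed

end

section \<open>The bracket at t = -1\<close>

context diagram
begin

text \<open>Here \<open>A ^ 2 = - \<i>\<close>, so the loop value is 0 and the weight of
  \<open>S\<close> among \<open>n\<close> crossings is \<open>A ^ n * \<i> ^ card S\<close>. As
  \<open>A\<close> has modulus 1, neither \<open>A ^ n\<close> nor the writhe factor affects the
  absolute value.\<close>

lemma link_det_eq:
  "link_det P Out = cmod (\<Sum>S\<in>Pow (crossings P). \<i> ^ card S * of_bool (card (state_circles P S) = 1))"
proof -
  define A where "A = inverse (csqrt (csqrt (-1)))"
  have ii: "csqrt (-1) = \<i>" by (simp add: csqrt_minus)
  have B2: "csqrt (csqrt (-1)) ^ 2 = \<i>" by (simp only: ii power2_csqrt)
  have norm: "cmod A = 1" unfolding A_def norm_inverse norm_csqrt by simp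
  then have A0: "A \<noteq> 0" by auto
  have A2: "A ^ 2 = - \<i>" "A powi (-2) = \<i>"
  proof -
    show "A ^ 2 = - \<i>" unfolding A_def power_inverse B2 by simp
    then show "A powi (-2) = \<i>" by (simp add: power_int_minus)
  qed
  then have \<delta>: "- (A powi 2) - A powi (-2) = 0" by simp
  have pos: "card (state_circles P S) \<noteq> 0" for S
  proof -
    have "state_circles P S \<noteq> {}" using outer_in by (auto simp: state_circles_def)
    moreover have "finite (state_circles P S)" using finite_darts by (simp add: state_circles_def)
    ultimately show ?thesis by simp
  qed
  have "kauffman_bracket P A = (\<Sum>S\<in>Pow (crossings P).
      A powi int (card (crossings P)) * (\<i> ^ card S * of_bool (card (state_circles P S) = 1)))"
    unfolding kauffman_bracket_def \<delta>
  proof (rule sum.cong[OF refl])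
    fix S assume "S \<in> Pow (crossings P)"
    then have S: "S \<subseteq> crossings P" "finite S" using finite_crossings finite_subset by auto
    then have "card S \<le> card (crossings P)" "card (crossings P - S) = card (crossings P) - card S"
      using finite_crossings by (auto simp: card_mono card_Diff_subset)
    then have e: "int (card (crossings P - S)) - int (card S) = int (card (crossings P)) + (-2) * int (card S)"
      by simp
    have "A powi (int (card (crossings P - S)) - int (card S)) = A powi int (card (crossings P)) * \<i> ^ card S"
      unfolding e power_int_add[OF disjI1[OF A0]] power_int_mult A2 power_int_of_nat ..
    \<comment> \<open>With truncated subtraction the exponent would also be 0 for a state without
      circles, which \<open>pos\<close> excludes.\<close>
    moreover have "(0 :: complex) ^ (card (state_circles P S) - 1) = of_bool (card (state_circles P S) = 1)"
      using pos[of S] by (simp add: power_0_left)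
    ultimately show "A powi (int (card (crossings P - S)) - int (card S)) * 0 ^ (card (state_circles P S) - 1)
      = A powi int (card (crossings P)) * (\<i> ^ card S * of_bool (card (state_circles P S) = 1))"
      by (simp only: mult.assoc)
  qed
  then show ?thesis
    unfolding link_det_def jones_def Let_def A_def[symmetric]
    by (simp add: norm_mult norm_power_int norm_power norm sum_distrib_left[symmetric])
qed

end

text \<open>A one-vertex all-A dessin means a single all-A circle. Its edges are the pairs of
  opposite over-darts, one pair per crossing, so edge sets correspond to states and
  \<open>swap\<close> to \<open>half_turn\<close>; both determinants become sums over the same
  sets.\<close>

lemma dessin_iso_all_A_link_det:
  fixes D :: "('v, 'd) dessin" and P :: "('w, 'c) link_diagram"
  assumes "dessin D" "num_verts D = 1" "base_dart D b" "connected_link_diagram P"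
    and iso: "dessin_iso D (all_A_dessin P)"
  shows "link_det P Out = cmod (Determinant.det (map_mat of_int (IM D b) - \<i> \<cdot>\<^sub>m 1\<^sub>m (num_edges D)))"
proof -
  interpret D: chord_diagram D b by unfold_locales (use assms in auto)
  obtain f g where f: "bij_betw f (verts D) (verts (all_A_dessin P))"
    and g: "bij_betw g (darts D) (darts (all_A_dessin P))"
    and gd: "\<And>d. d \<in> darts D \<Longrightarrow> nxt (all_A_dessin P) (g d) = g (nxt D d) \<and> opp (all_A_dessin P) (g d) = g (opp D d)"
    using iso unfolding dessin_iso_def by blast
  have "card (state_circles P {}) = 1"
    using bij_betw_same_card[OF f] assms(2) by (simp add: num_verts_def all_A_dessin_def)
  then interpret P: single_circle_diagram P by unfold_locales (use assms in auto)
  have gO: "bij_betw g (darts D) (over P)" using g by (simp add: all_A_dessin_def)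
  have g_over: "g d \<in> over P" if "d \<in> darts D" for d using gO that by (auto simp: bij_betw_def)
  have g_opp: "g (opp D d) = nxt (projection P) (nxt (projection P) (g d))" if "d \<in> darts D" for d
    using gd[OF that] g_over[OF that] by (simp add: all_A_dessin_def)
  let ?m = "num_edges D" and ?T = "\<lambda>F. transitive_on (nxt D \<circ> D.swap F) (darts D)"
  \<comment> \<open>Both ends of an edge sit at the same crossing, because \<open>opp\<close> of the
    all-A dessin is a half turn; hence any choice of an end will do.\<close>
  define \<psi> where "\<psi> c = vtx (projection P) (g (SOME d. d \<in> c))" for c
  have vx_opp: "vtx (projection P) (g (opp D d)) = vtx (projection P) (g d)" if "d \<in> darts D" for d
    using that P.over_subset[OF g_over[OF that]] by (simp add: g_opp)
  have \<psi>: "\<psi> (edge D d) = vtx (projection P) (g d)" if d: "d \<in> darts D" for d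
  proof -
    have "(SOME x. x \<in> edge D d) \<in> edge D d" by (rule someI[of _ d]) (simp add: edge_def)
    then show ?thesis using vx_opp[OF d] by (auto simp: \<psi>_def edge_def)
  qed
  have bij: "bij_betw \<psi> (edges D) (crossings P)"
    unfolding bij_betw_def
  proof
    show "inj_on \<psi> (edges D)"
    proof (rule inj_onI)
      fix c c' assume "c \<in> edges D" "c' \<in> edges D" and eq: "\<psi> c = \<psi> c'"
      then obtain d d' where d: "d \<in> darts D" "c = edge D d" "d' \<in> darts D" "c' = edge D d'"
        by (auto simp: edges_def)
      then have "g d' = g d \<or> g d' = g (opp D d)"
        using P.over_same_vertex[OF g_over[OF d(1)] g_over[OF d(3)]] eq by (simp add: \<psi> g_opp)
      then have "d' = d \<or> d' = opp D d"
        using d D.opp_in[OF d(1)] bij_betw_imp_inj_on[OF gO] by (auto dest: inj_onD)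
      then show "c = c'" using d D.edge_opp by auto
    qed
    show "\<psi> ` edges D = crossings P"
    proof
      show "\<psi> ` edges D \<subseteq> crossings P"
      proof
        fix v assume "v \<in> \<psi> ` edges D"
        then obtain d where "d \<in> darts D" "v = vtx (projection P) (g d)" by (auto simp: edges_def \<psi>)
        then show "v \<in> crossings P" using P.over_subset[OF g_over] unfolding crossing_darts_def by blast
      qed
      show "crossings P \<subseteq> \<psi> ` edges D"
      proof
        fix v assume "v \<in> crossings P"
        then obtain x where x: "x \<in> over P" "vtx (projection P) x = v" using P.crossing_over_dart by blast
        then have "x \<in> g ` darts D" using gO by (simp add: bij_betw_def)
        then obtain d where "d \<in> darts D" "x = g d" by blast
        then show "v \<in> \<psi> ` edges D" using x \<psi> by (force simp: edges_def)
      qed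
    qed
  qed
  have T: "card (state_circles P (\<psi> ` F)) = 1 \<longleftrightarrow> ?T F" if F: "F \<subseteq> edges D" for F
  proof -
    have sub: "\<psi> ` F \<subseteq> crossings P" using bij F by (auto simp: bij_betw_def)
    have g_swap: "P.half_turn (\<psi> ` F) (g d) = g (D.swap F d)" if d: "d \<in> darts D" for d
    proof -
      have "edge D d \<in> edges D" using d by (simp add: edges_def)
      then have "vtx (projection P) (g d) \<in> \<psi> ` F \<longleftrightarrow> edge D d \<in> F"
        using bij_betw_imp_inj_on[OF bij] F by (simp flip: \<psi>[OF d] add: inj_on_image_mem_iff)
      then show ?thesis
        using D.mem_Union_iff[OF F d] P.over_subset[OF g_over[OF d]] g_opp[OF d]
        by (simp add: P.half_turn_def D.swap_def)
    qed
    have "?T F \<longleftrightarrow> transitive_on (nxt (all_A_dessin P) \<circ> P.half_turn (\<psi> ` F)) (over P)"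
      by (rule transitive_on_bij[OF gO]) (use D.swap_in[OF F] D.nxt_in gd g_swap in auto)
    then show ?thesis using P.single_state_circle_iff_all_A[OF sub] by simp
  qed
  have card: "card (\<psi> ` F) = card F" if "F \<subseteq> edges D" for F
    using bij_betw_imp_inj_on[OF bij] that by (intro card_image) (rule inj_on_subset)
  have le: "card F \<le> ?m" if "F \<subseteq> edges D" for F
    using card_mono[OF D.finite_edges that] by (simp add: num_edges_def)
  have "(\<Sum>S\<in>Pow (crossings P). \<i> ^ card S * of_bool (card (state_circles P S) = 1))
    = (\<Sum>F\<in>Pow (edges D). \<i> ^ card (\<psi> ` F) * of_bool (card (state_circles P (\<psi> ` F)) = 1))"
    by (rule sum.reindex_bij_betw[OF bij_betw_Pow[OF bij], symmetric])
  also have "\<dots> = (\<Sum>F\<in>Pow (edges D). \<i> ^ card F * of_bool (?T F))"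
    by (rule sum.cong[OF refl]) (use card T in auto)
  finally have lhs: "link_det P Out = cmod (\<Sum>F\<in>Pow (edges D). \<i> ^ card F * of_bool (?T F))"
    by (simp add: P.link_det_eq)
  have "map_mat of_int (IM D b) - \<i> \<cdot>\<^sub>m 1\<^sub>m ?m = map_mat of_int (IM D b) + (- \<i>) \<cdot>\<^sub>m 1\<^sub>m ?m"
    by (rule eq_matI) (use D.IM_carrier in auto)
  then have "Determinant.det (map_mat of_int (IM D b) - \<i> \<cdot>\<^sub>m 1\<^sub>m ?m)
    = (\<Sum>F\<in>Pow (edges D). (- \<i>) ^ (?m - card F) * of_bool (?T F))"
    by (simp only: D.det_IM_add_scaled_one)
  \<comment> \<open>Since \<open>- \<i>\<close> and \<open>\<i>\<close> are inverse to each other,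
    the two sums differ only by the factor \<open>(- \<i>) ^ ?m\<close> of modulus 1.\<close>
  also have "\<dots> = (\<Sum>F\<in>Pow (edges D). (- \<i>) ^ ?m * (\<i> ^ card F * of_bool (?T F)))"
  proof (rule sum.cong[OF refl])
    fix F assume "F \<in> Pow (edges D)"
    then have "(- \<i>) ^ ?m = (- \<i>) ^ (?m - card F) * (- \<i>) ^ card F"
      using le[of F] by (simp flip: power_add)
    moreover have "(- \<i>) ^ card F * \<i> ^ card F = 1" by (simp flip: power_mult_distrib)
    ultimately show "(- \<i>) ^ (?m - card F) * of_bool (?T F) = (- \<i>) ^ ?m * (\<i> ^ card F * of_bool (?T F))"
      by (simp add: mult.assoc)
  qed
  finally show ?thesis
    unfolding lhs by (simp add: norm_mult norm_power sum_distrib_left[symmetric])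
qed

theorem theorem5p3:
  fixes D :: "('v, 'd) dessin" and b :: 'd and m :: nat
  assumes "dessin D" and "num_verts D = 1" and "base_dart D b" and "m = num_edges D"
  shows "Determinant.det (map_mat (\<lambda>a. [:a:]) (IM D b) - [:0, 1:] \<cdot>\<^sub>m 1\<^sub>m m)
           = (-1) ^ m * (\<Sum>j = 0..m div 2. monom (int (num_quasi_trees j D)) (m - 2 * j))
    \<and> (\<forall>(P :: ('w, 'c) link_diagram) Out.
         connected_link_diagram P \<longrightarrow> link_orientation P Out \<longrightarrow> dessin_iso D (all_A_dessin P) \<longrightarrow>
         link_det P Out = cmod (Determinant.det (map_mat of_int (IM D b) - \<i> \<cdot>\<^sub>m 1\<^sub>m m)))"
proof -
  interpret chord_diagram D b by unfold_locales (use assms in auto)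
  show ?thesis
    unfolding assms(4) using char_poly_IM dessin_iso_all_A_link_det[OF assms(1-3)] by blast
qed

end
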